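(* There is a polynomial-time algorithm that, given a graph $G=(V,E)$ and a family $\mathcal{B}\subseteq 2^V$, decides whether there exists a vertex cover $H\subseteq V$ of $G$ with $|H\cap B|\leq 1$ for every $B\in\mathcal{B}$ (and finds such an $H$ if it exists).
   Context: This is the Sparse Vertex Cover (Sparse-VC) problem with sparseness $k=1$: an instance consists of a graph $G=(V,E)$ and a family $\mathcal{B}\subseteq 2^V$; a feasible solution is a vertex cover $H\subseteq V$ (a set meeting every edge), and its sparseness is $\max_{B\in\mathcal{B}}|H\cap B|$. *)

theory Defs
  imports "HOL-Library.Log_Nat" "HOL-Computational_Algebra.Polynomial"
begin

section \<open>Model of computation: a random access machine with logarithmic cost\<close>

text \<open>
  Algorithms are structured programs over registers and arrays of natural numbers. As registers
  and arrays are named by literals, a program uses only finitely many of them; this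
  is a random access machine with several memories. Arithmetic is limited to addition
  and truncated subtraction, and every number that is read or computed, array indices included,
  is charged its binary length. Running time is therefore polynomially related to that of
  multitape Turing machines.
\<close>

datatype aexp =
    N nat
  | R nat
  | Get nat aexp
  | Plus aexp aexp
  | Minus aexp aexp

datatype bexp =
    Less aexp aexp
  | Eq aexp aexp
  | Not bexp
  | And bexp bexp

datatype com =
    Skip
  | SetReg nat aexp
  | SetArr nat aexp aexp
  | Seq com com
  | If bexp com com
  | While bexp com

record state =
  regs :: "nat \<Rightarrow> nat"
  arrs :: "nat \<Rightarrow> nat \<Rightarrow> nat"

text \<open>The number of binary digits plus one, so that \<open>0\<close> is not free.\<close>

definition len :: "nat \<Rightarrow> nat" where
  "len n = floorlog 2 n + 1"

fun aval :: "aexp \<Rightarrow> state \<Rightarrow> nat" where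
  "aval (N n) s = n"
| "aval (R r) s = regs s r"
| "aval (Get a e) s = arrs s a (aval e s)"
| "aval (Plus e1 e2) s = aval e1 s + aval e2 s"
| "aval (Minus e1 e2) s = aval e1 s - aval e2 s"

fun bval :: "bexp \<Rightarrow> state \<Rightarrow> bool" where
  "bval (Less e1 e2) s \<longleftrightarrow> aval e1 s < aval e2 s"
| "bval (Eq e1 e2) s \<longleftrightarrow> aval e1 s = aval e2 s"
| "bval (Not b) s \<longleftrightarrow> \<not> bval b s"
| "bval (And b1 b2) s \<longleftrightarrow> bval b1 s \<and> bval b2 s"

fun acost :: "aexp \<Rightarrow> state \<Rightarrow> nat" where
  "acost (N n) s = len n"
| "acost (R r) s = len (regs s r)"
| "acost (Get a e) s = acost e s + len (arrs s a (aval e s))"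
| "acost (Plus e1 e2) s = acost e1 s + acost e2 s + len (aval e1 s + aval e2 s)"
| "acost (Minus e1 e2) s = acost e1 s + acost e2 s + len (aval e1 s - aval e2 s)"

fun bcost :: "bexp \<Rightarrow> state \<Rightarrow> nat" where
  "bcost (Less e1 e2) s = acost e1 s + acost e2 s + 1"
| "bcost (Eq e1 e2) s = acost e1 s + acost e2 s + 1"
| "bcost (Not b) s = bcost b s + 1"
| "bcost (And b1 b2) s = bcost b1 s + bcost b2 s + 1"

text \<open>\<open>exec c s t s'\<close>: started in \<open>s\<close>, the program \<open>c\<close> halts in \<open>s'\<close> after time \<open>t\<close>.\<close>

inductive exec :: "com \<Rightarrow> state \<Rightarrow> nat \<Rightarrow> state \<Rightarrow> bool" where
  Skip: "exec Skip s 1 s"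
| SetReg: "exec (SetReg r e) s (acost e s + 1) (s\<lparr>regs := (regs s)(r := aval e s)\<rparr>)"
| SetArr: "exec (SetArr a i e) s (acost i s + acost e s + 1)
    (s\<lparr>arrs := (arrs s)(a := (arrs s a)(aval i s := aval e s))\<rparr>)"
| Seq: "exec c1 s1 t1 s2 \<Longrightarrow> exec c2 s2 t2 s3 \<Longrightarrow> exec (Seq c1 c2) s1 (t1 + t2) s3"
| IfTrue: "bval b s \<Longrightarrow> exec c1 s t s' \<Longrightarrow> exec (If b c1 c2) s (bcost b s + t + 1) s'"
| IfFalse: "\<not> bval b s \<Longrightarrow> exec c2 s t s' \<Longrightarrow> exec (If b c1 c2) s (bcost b s + t + 1) s'"
| WhileFalse: "\<not> bval b s \<Longrightarrow> exec (While b c) s (bcost b s + 1) s"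
| WhileTrue: "bval b s1 \<Longrightarrow> exec c s1 t1 s2 \<Longrightarrow> exec (While b c) s2 t2 s3 \<Longrightarrow>
    exec (While b c) s1 (bcost b s1 + t1 + t2 + 1) s3"

inductive_cases exec_SkipE: "exec Skip s t s'"
inductive_cases exec_SetRegE: "exec (SetReg r e) s t s'"
inductive_cases exec_SetArrE: "exec (SetArr a i e) s t s'"
inductive_cases exec_SeqE: "exec (Seq c1 c2) s t s'"
inductive_cases exec_IfE: "exec (If b c1 c2) s t s'"
inductive_cases exec_WhileE: "exec (While b c) s t s'"

lemma exec_deterministic:
  assumes "exec c s t s'" and "exec c s u s''"
  shows "u = t \<and> s'' = s'"
  using assms
proof (induction arbitrary: u s'' rule: exec.induct)
  case (Seq c1 s1 t1 s2 c2 t2 s3)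
  from Seq.prems obtain v1 r v2 where
    "exec c1 s1 v1 r" "exec c2 r v2 s''" "u = v1 + v2"
    by (auto elim: exec_SeqE)
  with Seq.IH show ?case by metis
next
  case (IfTrue b s c1 t s' c2)
  from IfTrue.prems IfTrue.hyps obtain v where
    "exec c1 s v s''" "u = bcost b s + v + 1"
    by (auto elim: exec_IfE)
  with IfTrue.IH show ?case by metis
next
  case (IfFalse b s c2 t s' c1)
  from IfFalse.prems IfFalse.hyps obtain v where
    "exec c2 s v s''" "u = bcost b s + v + 1"
    by (auto elim: exec_IfE)
  with IfFalse.IH show ?case by metis
next
  case (WhileFalse b s c)
  from WhileFalse.prems WhileFalse.hyps show ?case
    by (auto elim: exec_WhileE)
next
  case (WhileTrue b s1 c t1 s2 t2 s3)
  from WhileTrue.prems WhileTrue.hyps obtain v1 r v2 where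
    "exec c s1 v1 r" "exec (While b c) r v2 s''" "u = bcost b s1 + v1 + v2 + 1"
    by (auto elim: exec_WhileE)
  with WhileTrue.IH show ?case by metis
qed (auto elim: exec_SkipE exec_SetRegE exec_SetArrE)

text \<open>
  The input is placed in array \<open>0\<close> and its length in register \<open>0\<close>; all other cells are \<open>0\<close>.
  The output is read from array \<open>1\<close>, its length from register \<open>1\<close>.
\<close>

definition init_state :: "nat list \<Rightarrow> state" where
  "init_state x = \<lparr>regs = (\<lambda>_. 0)(0 := length x),
     arrs = (\<lambda>a i. if a = 0 \<and> i < length x then x ! i else 0)\<rparr>"

definition output_of :: "state \<Rightarrow> nat list" where
  "output_of s = map (arrs s 1) [0..<regs s 1]"

definition input_size :: "nat list \<Rightarrow> nat" where
  "input_size x = (\<Sum>n\<leftarrow>x. len n)"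


section \<open>Sparse vertex covers\<close>

text \<open>Vertices are named by natural numbers, which need not form an initial segment.\<close>

definition simple_graph :: "nat set \<Rightarrow> nat set set \<Rightarrow> bool" where
  "simple_graph V E \<longleftrightarrow> finite V \<and> (\<forall>e\<in>E. e \<subseteq> V \<and> card e = 2)"

definition vertex_cover :: "nat set \<Rightarrow> nat set set \<Rightarrow> nat set \<Rightarrow> bool" where
  "vertex_cover V E H \<longleftrightarrow> H \<subseteq> V \<and> (\<forall>e\<in>E. H \<inter> e \<noteq> {})"

text \<open>
  An instance is written down by listing its vertices, its edges and the members of the family,
  each list preceded by its length. Lists may be in any order and may contain repetitions.
\<close>

definition encode :: "nat list \<Rightarrow> (nat \<times> nat) list \<Rightarrow> nat list list \<Rightarrow> nat list" where
  "encode vs es bs =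
     length vs # vs @
     length es # concat (map (\<lambda>(u, v). [u, v]) es) @
     length bs # concat (map (\<lambda>b. length b # b) bs)"

definition encodes_instance ::
    "nat list \<Rightarrow> nat set \<Rightarrow> nat set set \<Rightarrow> nat set set \<Rightarrow> bool" where
  "encodes_instance x V E \<B> \<longleftrightarrow>
     (\<exists>vs es bs. x = encode vs es bs \<and> V = set vs \<and>
        E = (\<lambda>(u, v). {u, v}) ` set es \<and> \<B> = set ` set bs)"

end

theory Submission
  imports Defs
begin

text \<open>
  Sparseness one makes the problem an instance of 2-satisfiability: an edge \<open>{u, v}\<close> forbids
  that both ends are absent, two members of a set of the family must not both be present. The
  program lists the corresponding implications between literals and then fixes the vertices one
  by one. It puts a vertex into the cover if the literals implied by all choices made so far remain
  consistent, and leaves it out otherwise. A consistent set of literals that is closed under implication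
  can override any solution, so one of the two choices keeps it consistent whenever the
  instance is solvable. Running times are counted in steps first: a step lengthens the numbers in memory
  by a constant number of bits only, so a polynomial number of steps has polynomial logarithmic cost.
\<close>

section \<open>Counting steps instead of bits\<close>

text \<open>Each binary clause contributes both of its contrapositive implications. A closed set
  that falsifies one literal of a clause therefore contains the other, so every clause is either
  satisfied by the closed set or has no falsified literal; this is what makes an early choice safe.
  The second choice for a vertex is never tested. Solvability is only a premise of the invariant
  that keeps the choices consistent. Soundness comes from elsewhere: once every vertex has a chosen
  literal, a consistent closure is itself a cover, so one test at the end separates the two answers.
  Implied literals are found by sweeping the list of implications as often as it has entries. This
  is wasteful, but needs only counting loops, whose step bounds are products. Without multiplication
  a number can at most be doubled by each addition, so \<open>n\<close> steps produce numbers of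
  O(n) additional bits. This is why counting steps suffices.\<close>

inductive steps :: "com \<Rightarrow> state \<Rightarrow> nat \<Rightarrow> state \<Rightarrow> bool" where
  Skip: "steps Skip s 1 s"
| SetReg: "steps (SetReg r e) s 1 (s\<lparr>regs := (regs s)(r := aval e s)\<rparr>)"
| SetArr: "steps (SetArr a i e) s 1 (s\<lparr>arrs := (arrs s)(a := (arrs s a)(aval i s := aval e s))\<rparr>)"
| Seq: "steps c1 s1 n1 s2 \<Longrightarrow> steps c2 s2 n2 s3 \<Longrightarrow> steps (Seq c1 c2) s1 (n1 + n2) s3"
| IfTrue: "bval b s \<Longrightarrow> steps c1 s n s' \<Longrightarrow> steps (If b c1 c2) s (n + 1) s'"
| IfFalse: "\<not> bval b s \<Longrightarrow> steps c2 s n s' \<Longrightarrow> steps (If b c1 c2) s (n + 1) s'"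
| WhileFalse: "\<not> bval b s \<Longrightarrow> steps (While b c) s 1 s"
| WhileTrue: "bval b s1 \<Longrightarrow> steps c s1 n1 s2 \<Longrightarrow> steps (While b c) s2 n2 s3 \<Longrightarrow>
    steps (While b c) s1 (n1 + n2 + 1) s3"

text \<open>One measure serves two purposes: it bounds the bits by which a value can exceed the
  longest number in memory, and the number of charges made during evaluation. A constant
  \<open>n\<close> gets \<open>n + 1\<close> because \<open>n < 2 ^ n\<close>; this is crude, but
  depends on the program only.\<close>

fun aweight :: "aexp \<Rightarrow> nat" where
  "aweight (N n) = n + 1"
| "aweight (R r) = 1"
| "aweight (Get a e) = aweight e + 1"
| "aweight (Plus e1 e2) = aweight e1 + aweight e2 + 1"
| "aweight (Minus e1 e2) = aweight e1 + aweight e2 + 1"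

fun bweight :: "bexp \<Rightarrow> nat" where
  "bweight (Less e1 e2) = aweight e1 + aweight e2 + 1"
| "bweight (Eq e1 e2) = aweight e1 + aweight e2 + 1"
| "bweight (Not b) = bweight b + 1"
| "bweight (And b1 b2) = bweight b1 + bweight b2 + 1"

fun cweight :: "com \<Rightarrow> nat" where
  "cweight Skip = 1"
| "cweight (SetReg r e) = aweight e + 1"
| "cweight (SetArr a i e) = aweight i + aweight e + 1"
| "cweight (Seq c1 c2) = cweight c1 + cweight c2"
| "cweight (If b c1 c2) = bweight b + cweight c1 + cweight c2 + 1"
| "cweight (While b c) = bweight b + cweight c + 1"

definition fits :: "nat \<Rightarrow> state \<Rightarrow> bool" where
  "fits m s \<longleftrightarrow> (\<forall>r. regs s r < 2 ^ m) \<and> (\<forall>a i. arrs s a i < 2 ^ m)"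

lemma len_le: "v < 2 ^ m \<Longrightarrow> len v \<le> m + 1"
  by (simp add: len_def floorlog_le_iff)

lemma less_power_mono: "v < 2 ^ m \<Longrightarrow> m \<le> n \<Longrightarrow> v < (2::nat) ^ n"
  by (meson less_le_trans one_le_numeral power_increasing)

lemma less_power_len: "v < 2 ^ len v"
proof -
  have "v < 2 ^ floorlog 2 v"
    using floorlog_bounds[of v 2] by (cases "v = 0") auto
  also have "\<dots> \<le> 2 ^ len v"
    by (simp add: len_def)
  finally show ?thesis .
qed

lemma fits_mono: "fits m s \<Longrightarrow> m \<le> n \<Longrightarrow> fits n s"
  unfolding fits_def by (meson less_power_mono)

lemma aval_less: "fits m s \<Longrightarrow> aval e s < 2 ^ (m + aweight e)"
proof (induction e)
  case (N n)
  have "n < 2 ^ n" by simp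
  also have "\<dots> \<le> 2 ^ (m + (n + 1))" by (rule power_increasing) auto
  finally show ?case by simp
next
  case (R r)
  then show ?case using less_power_mono[of "regs s r" m "m + 1"] by (simp add: fits_def)
next
  case (Get a e)
  then show ?case
    using less_power_mono[of "arrs s a (aval e s)" m "m + (aweight e + 1)"] by (simp add: fits_def)
next
  case (Plus e1 e2)
  let ?k = "m + (aweight e1 + aweight e2)"
  have "aval e1 s < 2 ^ ?k" "aval e2 s < 2 ^ ?k"
    by (rule less_power_mono[OF Plus.IH(1)[OF Plus.prems]]
      less_power_mono[OF Plus.IH(2)[OF Plus.prems]], simp)+
  then show ?case by simp
next
  case (Minus e1 e2)
  have "aval e1 s < 2 ^ (m + (aweight e1 + aweight e2 + 1))"
    by (rule less_power_mono[OF Minus.IH(1)[OF Minus.prems]]) simp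
  then show ?case by simp
qed

text \<open>Every subexpression has weight at most \<open>w\<close>, so one common bound on lengths
  applies to all nodes, and there are at most \<open>aweight e\<close> of them.\<close>

lemma acost_le:
  assumes "fits m s" "aweight e \<le> w"
  shows "acost e s \<le> aweight e * (m + w + 1)"
proof -
  define B where "B = m + w + 1"
  have len_aval: "len (aval e' s) \<le> B" if "aweight e' \<le> w" for e'
    using len_le[OF aval_less[OF assms(1), of e']] that by (simp add: B_def)
  have "acost e s \<le> aweight e * B"
    using assms(2)
  proof (induction e)
    case (N n)
    then show ?case using len_aval[of "N n"] by simp
  next
    case (R r)
    then show ?case using len_aval[of "R r"] by simp
  next
    case (Get a e)
    then show ?case using len_aval[of "Get a e"] by simp
  next
    case (Plus e1 e2)
    then show ?case using len_aval[of "Plus e1 e2"] by (simp add: distrib_right)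
  next
    case (Minus e1 e2)
    then show ?case using len_aval[of "Minus e1 e2"] by (simp add: distrib_right)
  qed
  then show ?thesis by (simp only: B_def)
qed

lemma bcost_le:
  assumes "fits m s" "bweight b \<le> w"
  shows "bcost b s \<le> bweight b * (m + w + 1)"
proof -
  define B where "B = m + w + 1"
  have acost: "acost e s \<le> aweight e * B" if "aweight e \<le> w" for e
    using acost_le[OF assms(1) that] by (simp only: B_def)
  have "1 \<le> B" by (simp add: B_def)
  have "bcost b s \<le> bweight b * B"
    using assms(2)
  proof (induction b)
    case (Less e1 e2)
    then show ?case using acost[of e1] acost[of e2] \<open>1 \<le> B\<close> by (simp add: distrib_right)
  next
    case (Eq e1 e2)
    then show ?case using acost[of e1] acost[of e2] \<open>1 \<le> B\<close> by (simp add: distrib_right)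
  next
    case (Not b)
    then show ?case using \<open>1 \<le> B\<close> by simp
  next
    case (And b1 b2)
    then show ?case using \<open>1 \<le> B\<close> by (simp add: distrib_right)
  qed
  then show ?thesis by (simp only: B_def)
qed

text \<open>A bound for the charge of one elementary step while all numbers in memory have at most
  \<open>m\<close> bits; the final \<open>1\<close> is the fixed charge of the step.\<close>

definition stepcost :: "nat \<Rightarrow> nat \<Rightarrow> nat" where
  "stepcost w m = w * (m + w + 1) + 1"

lemma stepcost_mono: "m \<le> m' \<Longrightarrow> stepcost w m \<le> stepcost w m'"
  by (simp add: stepcost_def)

lemma mult_stepcost_mono:
  "t \<le> n * stepcost w m \<Longrightarrow> m \<le> m' \<Longrightarrow> t \<le> n * stepcost w m'"
  by (meson le_trans mult_le_mono2 stepcost_mono)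

lemma less_stepcost:
  assumes "a \<le> k * (m + w + 1)" "k \<le> w" "m \<le> m'"
  shows "a + 1 \<le> stepcost w m'"
proof -
  have "k * (m + w + 1) \<le> w * (m' + w + 1)"
    using assms(2,3) by (intro mult_mono) auto
  with assms(1) show ?thesis by (simp add: stepcost_def)
qed

text \<open>A step lengthens the numbers in memory by at most the weight of the program, so the
  logarithmic cost of a run is polynomial in its number of steps.\<close>

lemma steps_exec:
  assumes "steps c s n s'" "cweight c \<le> w" "fits m s"
  shows "fits (m + n * w) s' \<and> (\<exists>t. exec c s t s' \<and> t \<le> n * stepcost w (m + n * w))"
  using assms
proof (induction arbitrary: m rule: steps.induct)
  case (Skip s)
  then show ?case
    using fits_mono[of m s "m + w"] exec.Skip[of s] by (auto simp: stepcost_def)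
next
  case (SetReg r e s)
  then have "aval e s < 2 ^ (m + w)"
    by (intro less_power_mono[OF aval_less[of m s e]]) auto
  moreover have "acost e s + 1 \<le> stepcost w (m + w)"
    using acost_le[of m s e w] SetReg.prems
    by (intro less_stepcost[where k = "aweight e" and m = m]) auto
  ultimately show ?case
    using fits_mono[OF SetReg.prems(2), of "m + w"] exec.SetReg[of r e s]
    by (auto simp: fits_def)
next
  case (SetArr a i e s)
  then have "aval e s < 2 ^ (m + w)"
    by (intro less_power_mono[OF aval_less[of m s e]]) auto
  moreover have "acost i s + acost e s + 1 \<le> stepcost w (m + w)"
  proof (rule less_stepcost)
    show "acost i s + acost e s \<le> (aweight i + aweight e) * (m + w + 1)"
      using acost_le[of m s i w] acost_le[of m s e w] SetArr.prems by (simp add: algebra_simps)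
  qed (use SetArr.prems in auto)
  ultimately show ?case
    using fits_mono[OF SetArr.prems(2), of "m + w"] exec.SetArr[of a i e s]
    by (auto simp: fits_def)
next
  case (Seq c1 s1 n1 s2 c2 n2 s3)
  \<comment> \<open>Both halves are charged at the number length allowed at the end of the run,
    which dominates all earlier ones.\<close>
  let ?m = "m + (n1 + n2) * w"
  have w: "cweight c1 \<le> w" "cweight c2 \<le> w" using Seq.prems by auto
  obtain t1 where 1: "fits (m + n1 * w) s2"
    "exec c1 s1 t1 s2" "t1 \<le> n1 * stepcost w (m + n1 * w)"
    using Seq.IH(1)[OF w(1) Seq.prems(2)] by auto
  obtain t2 where 2: "fits (m + n1 * w + n2 * w) s3"
    "exec c2 s2 t2 s3" "t2 \<le> n2 * stepcost w (m + n1 * w + n2 * w)"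
    using Seq.IH(2)[OF w(2) 1(1)] by auto
  have "t1 \<le> n1 * stepcost w ?m" "t2 \<le> n2 * stepcost w ?m"
    by (rule mult_stepcost_mono[OF 1(3)] mult_stepcost_mono[OF 2(3)], simp add: algebra_simps)+
  then have "t1 + t2 \<le> (n1 + n2) * stepcost w ?m" by (simp add: algebra_simps)
  moreover have "fits ?m s3" using 2(1) by (simp add: algebra_simps)
  ultimately show ?case using exec.Seq[OF 1(2) 2(2)] by blast
next
  case (IfTrue b s c1 n s' c2)
  let ?m = "m + (n + 1) * w"
  have w: "cweight c1 \<le> w" "bweight b \<le> w" using IfTrue.prems by auto
  obtain t where 1: "fits (m + n * w) s'" "exec c1 s t s'" "t \<le> n * stepcost w (m + n * w)"
    using IfTrue.IH[OF w(1) IfTrue.prems(2)] by auto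
  have "t \<le> n * stepcost w ?m" by (rule mult_stepcost_mono[OF 1(3)]) simp
  moreover have "bcost b s + 1 \<le> stepcost w ?m"
    by (rule less_stepcost[OF bcost_le[OF IfTrue.prems(2) w(2)] w(2)]) simp
  ultimately have "bcost b s + t + 1 \<le> (n + 1) * stepcost w ?m" by simp
  moreover have "fits ?m s'" using fits_mono[OF 1(1)] by simp
  ultimately show ?case using exec.IfTrue[OF IfTrue.hyps(1) 1(2)] by blast
next
  case (IfFalse b s c2 n s' c1)
  let ?m = "m + (n + 1) * w"
  have w: "cweight c2 \<le> w" "bweight b \<le> w" using IfFalse.prems by auto
  obtain t where 1: "fits (m + n * w) s'" "exec c2 s t s'" "t \<le> n * stepcost w (m + n * w)"
    using IfFalse.IH[OF w(1) IfFalse.prems(2)] by auto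
  have "t \<le> n * stepcost w ?m" by (rule mult_stepcost_mono[OF 1(3)]) simp
  moreover have "bcost b s + 1 \<le> stepcost w ?m"
    by (rule less_stepcost[OF bcost_le[OF IfFalse.prems(2) w(2)] w(2)]) simp
  ultimately have "bcost b s + t + 1 \<le> (n + 1) * stepcost w ?m" by simp
  moreover have "fits ?m s'" using fits_mono[OF 1(1)] by simp
  ultimately show ?case using exec.IfFalse[OF IfFalse.hyps(1) 1(2)] by blast
next
  case (WhileFalse b s c)
  have w: "bweight b \<le> w" using WhileFalse.prems by auto
  have "bcost b s + 1 \<le> 1 * stepcost w (m + 1 * w)"
    using less_stepcost[OF bcost_le[OF WhileFalse.prems(2) w] w, of "m + w"] by simp
  moreover have "fits (m + 1 * w) s" using fits_mono[OF WhileFalse.prems(2)] by simp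
  ultimately show ?case using exec.WhileFalse[of b s c, OF WhileFalse.hyps(1)] by blast
next
  case (WhileTrue b s1 c n1 s2 n2 s3)
  let ?m = "m + (n1 + n2 + 1) * w"
  have w: "cweight c \<le> w" "bweight b \<le> w" using WhileTrue.prems by auto
  obtain t1 where 1: "fits (m + n1 * w) s2"
    "exec c s1 t1 s2" "t1 \<le> n1 * stepcost w (m + n1 * w)"
    using WhileTrue.IH(1)[OF w(1) WhileTrue.prems(2)] by auto
  obtain t2 where 2: "fits (m + n1 * w + n2 * w) s3"
    "exec (While b c) s2 t2 s3" "t2 \<le> n2 * stepcost w (m + n1 * w + n2 * w)"
    using WhileTrue.IH(2)[OF WhileTrue.prems(1) 1(1)] by auto
  have "t1 \<le> n1 * stepcost w ?m" "t2 \<le> n2 * stepcost w ?m"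
    by (rule mult_stepcost_mono[OF 1(3)] mult_stepcost_mono[OF 2(3)], simp add: algebra_simps)+
  moreover have "bcost b s1 + 1 \<le> stepcost w ?m"
    by (rule less_stepcost[OF bcost_le[OF WhileTrue.prems(2) w(2)] w(2)]) simp
  ultimately have "bcost b s1 + t1 + t2 + 1 \<le> (n1 + n2 + 1) * stepcost w ?m"
    by (simp add: algebra_simps)
  moreover have "fits ?m s3"
    by (rule fits_mono[OF 2(1)]) (simp add: algebra_simps)
  ultimately show ?case
    using exec.WhileTrue[OF WhileTrue.hyps(1) 1(2) 2(2)] by blast
qed

lemma length_le_input_size: "length x \<le> input_size x"
  unfolding input_size_def by (induction x) (auto simp: len_def)

text \<open>No entry is longer than the sum of all lengths; the content of register \<open>0\<close>
  is bounded because each entry is charged at least one unit.\<close>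

lemma fits_init_state: "fits (input_size x) (init_state x)"
proof -
  have "v < 2 ^ input_size x" if "v \<in> set x" for v
  proof -
    have "len v \<le> input_size x"
      unfolding input_size_def using that by (intro member_le_sum_list) auto
    with less_power_len[of v] show ?thesis by (rule less_power_mono)
  qed
  moreover have "length x < 2 ^ input_size x"
    using le_less_trans[OF length_le_input_size less_exp] .
  ultimately show ?thesis
    by (auto simp: fits_def init_state_def)
qed

section \<open>Total correctness with step bounds\<close>

text \<open>A total-correctness triple with a step budget. The start state is explicit, so that
  postconditions can refer to it.\<close>

definition tri :: "com \<Rightarrow> state \<Rightarrow> nat \<Rightarrow> (state \<Rightarrow> bool) \<Rightarrow> bool" where
  "tri c s n Q \<longleftrightarrow> (\<exists>k s'. steps c s k s' \<and> k \<le> n \<and> Q s')"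

lemma tri_weaken: "tri c s n P \<Longrightarrow> n \<le> n' \<Longrightarrow> (\<And>s'. P s' \<Longrightarrow> Q s') \<Longrightarrow> tri c s n' Q"
  unfolding tri_def using le_trans by blast

lemma tri_Seq:
  assumes "tri c1 s n1 P" "\<And>s'. P s' \<Longrightarrow> tri c2 s' n2 Q"
  shows "tri (Seq c1 c2) s (n1 + n2) Q"
proof -
  from assms(1) obtain k1 s1 where 1: "steps c1 s k1 s1" "k1 \<le> n1" "P s1"
    unfolding tri_def by auto
  from assms(2)[OF 1(3)] obtain k2 s2 where "steps c2 s1 k2 s2" "k2 \<le> n2" "Q s2"
    unfolding tri_def by auto
  with steps.Seq[OF 1(1)] add_mono[OF 1(2)] show ?thesis unfolding tri_def by blast
qed

fun straight :: "com \<Rightarrow> bool" where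
  "straight (While b c) = False"
| "straight (Seq c1 c2) = (straight c1 \<and> straight c2)"
| "straight (If b c1 c2) = (straight c1 \<and> straight c2)"
| "straight c = True"

text \<open>Loop-free code is executed symbolically by the simplifier. The value at
  \<open>While\<close> is a dummy, excluded by \<open>straight\<close>.\<close>

fun run :: "com \<Rightarrow> state \<Rightarrow> state" where
  "run (SetReg r e) s = s\<lparr>regs := (regs s)(r := aval e s)\<rparr>"
| "run (SetArr a i e) s = s\<lparr>arrs := (arrs s)(a := (arrs s a)(aval i s := aval e s))\<rparr>"
| "run (Seq c1 c2) s = run c2 (run c1 s)"
| "run (If b c1 c2) s = (if bval b s then run c1 s else run c2 s)"
| "run c s = s"

fun ticks :: "com \<Rightarrow> nat" where
  "ticks (Seq c1 c2) = ticks c1 + ticks c2"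
| "ticks (If b c1 c2) = ticks c1 + ticks c2 + 1"
| "ticks c = 1"

lemma steps_run: "straight c \<Longrightarrow> \<exists>k. steps c s k (run c s) \<and> k \<le> ticks c"
proof (induction c arbitrary: s)
  case (Seq c1 c2)
  obtain k1 where 1: "steps c1 s k1 (run c1 s)" "k1 \<le> ticks c1"
    using Seq.IH(1)[of s] Seq.prems by auto
  obtain k2 where 2: "steps c2 (run c1 s) k2 (run c2 (run c1 s))" "k2 \<le> ticks c2"
    using Seq.IH(2)[of "run c1 s"] Seq.prems by auto
  show ?case
    using steps.Seq[OF 1(1) 2(1)] 1(2) 2(2) by (intro exI[of _ "k1 + k2"]) simp
next
  case (If b c1 c2)
  show ?case
  proof (cases "bval b s")
    case True
    obtain k where 1: "steps c1 s k (run c1 s)" "k \<le> ticks c1"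
      using If.IH(1)[of s] If.prems by auto
    show ?thesis
      using steps.IfTrue[OF True 1(1), of c2] 1(2) True by (intro exI[of _ "k + 1"]) simp
  next
    case False
    obtain k where 1: "steps c2 s k (run c2 s)" "k \<le> ticks c2"
      using If.IH(2)[of s] If.prems by auto
    show ?thesis
      using steps.IfFalse[OF False 1(1), of c1] 1(2) False by (intro exI[of _ "k + 1"]) simp
  qed
next
  case Skip
  show ?case using steps.Skip by (intro exI[of _ 1]) simp
next
  case (SetReg r e)
  show ?case using steps.SetReg by (intro exI[of _ 1]) simp
next
  case (SetArr a i e)
  show ?case using steps.SetArr by (intro exI[of _ 1]) simp
qed simp

lemma tri_run: "straight c \<Longrightarrow> ticks c \<le> n \<Longrightarrow> Q (run c s) \<Longrightarrow> tri c s n Q"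
  unfolding tri_def using steps_run[of c s] by (auto intro: le_trans)

lemma tri_If:
  assumes "bval b s \<Longrightarrow> tri c1 s n Q" "\<not> bval b s \<Longrightarrow> tri c2 s n Q"
  shows "tri (If b c1 c2) s (n + 1) Q"
proof (cases "bval b s")
  case True
  obtain k s' where "steps c1 s k s'" "k \<le> n" "Q s'"
    using assms(1)[OF True] unfolding tri_def by blast
  with steps.IfTrue[OF True] show ?thesis unfolding tri_def by (meson add_le_mono1)
next
  case False
  obtain k s' where "steps c2 s k s'" "k \<le> n" "Q s'"
    using assms(2)[OF False] unfolding tri_def by blast
  with steps.IfFalse[OF False] show ?thesis unfolding tri_def by (meson add_le_mono1)
qed

definition For :: "nat \<Rightarrow> nat \<Rightarrow> com \<Rightarrow> com" where
  "For i b c = Seq (SetReg i (N 0))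
     (While (Less (R i) (R b)) (Seq c (SetReg i (Plus (R i) (N 1)))))"

text \<open>An iteration costs the body, the increment and the test; the remaining \<open>2\<close>
  is the initial assignment and the last, failing test. \<open>M\<close> replaces the true count
  \<open>m\<close>, so that nested loops get bounds in the input length alone.\<close>

lemma tri_For:
  assumes init: "P 0 (s\<lparr>regs := (regs s)(i := 0)\<rparr>)"
    and counter: "\<And>j s. P j s \<Longrightarrow> regs s i = j \<and> regs s b = m"
    and le: "m \<le> M"
    and body: "\<And>j s. j < m \<Longrightarrow> P j s \<Longrightarrow>
      tri c s n (\<lambda>s'. P (Suc j) (s'\<lparr>regs := (regs s')(i := Suc (regs s' i))\<rparr>))"
  shows "tri (For i b c) s (M * (n + 2) + 2) (P m)"
proof -
  let ?c = "Seq c (SetReg i (Plus (R i) (N 1)))"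
  let ?W = "While (Less (R i) (R b)) ?c"
  have loop: "\<exists>k s'. steps ?W s k s' \<and> k \<le> (m - j) * (n + 2) + 1 \<and> P m s'"
    if "j \<le> m" "P j s" for j s
    using that
  \<comment> \<open>The induction runs downward from \<open>m\<close>, as the remaining time is
    governed by \<open>m - j\<close>.\<close>
  proof (induction j arbitrary: s rule: inc_induct)
    case base
    then have "\<not> bval (Less (R i) (R b)) s" using counter[of m s] by simp
    from steps.WhileFalse[OF this] base show ?case by fastforce
  next
    case (step j)
    have b: "bval (Less (R i) (R b)) s" using counter[OF step.prems] step.hyps by simp
    from body[OF step.hyps(2) step.prems] obtain k1 s1 where 1: "steps c s k1 s1" "k1 \<le> n"
      "P (Suc j) (s1\<lparr>regs := (regs s1)(i := Suc (regs s1 i))\<rparr>)" (is "P _ ?s2")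
      unfolding tri_def by auto
    have c: "steps ?c s (k1 + 1) ?s2"
      using steps.Seq[OF 1(1) steps.SetReg[of i "Plus (R i) (N 1)" s1]] by simp
    from step.IH[OF 1(3)] obtain k2 s3 where 2: "steps ?W ?s2 k2 s3"
      "k2 \<le> (m - Suc j) * (n + 2) + 1" "P m s3" by auto
    have "k1 + 1 + k2 + 1 \<le> (m - j) * (n + 2) + 1"
    proof -
      have "m - j = Suc (m - Suc j)" using step.hyps by simp
      then show ?thesis using 1(2) 2(2) by simp
    qed
    with steps.WhileTrue[OF b c 2(1)] 2(3) show ?case by blast
  qed
  have "tri ?W (s\<lparr>regs := (regs s)(i := 0)\<rparr>) (m * (n + 2) + 1) (P m)"
    unfolding tri_def using loop[OF _ init] by simp
  moreover have "m * (n + 2) \<le> M * (n + 2)" using le by (rule mult_right_mono) simp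
  ultimately have "tri ?W (s\<lparr>regs := (regs s)(i := 0)\<rparr>) (M * (n + 2) + 1) (P m)"
    by (auto elim: tri_weaken)
  then have "tri (For i b c) s (1 + (M * (n + 2) + 1)) (P m)"
    unfolding For_def
    by (intro tri_Seq[where P = "\<lambda>s'. s' = s\<lparr>regs := (regs s)(i := 0)\<rparr>"]) (auto intro: tri_run)
  then show ?thesis by simp
qed

section \<open>Sparse vertex covers as 2-satisfiability\<close>

text \<open>Literals are coded as odd and even numbers: they can then index arrays and be computed
  by additions.\<close>

definition pos :: "nat \<Rightarrow> nat" where
  "pos v = Suc (v + v)"

definition neg :: "nat \<Rightarrow> nat" where
  "neg v = v + v"

lemma pos_eq_iff [simp]: "pos u = pos v \<longleftrightarrow> u = v"
  unfolding pos_def by presburger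

lemma neg_eq_iff [simp]: "neg u = neg v \<longleftrightarrow> u = v"
  unfolding neg_def by presburger

lemma pos_neq_neg [simp]: "pos u \<noteq> neg v" "neg v \<noteq> pos u"
  unfolding pos_def neg_def by presburger+

definition literals :: "nat set \<Rightarrow> nat set" where
  "literals V = pos ` V \<union> neg ` V"

definition truths :: "nat set \<Rightarrow> nat set \<Rightarrow> nat set" where
  "truths V H = pos ` H \<union> neg ` (V - H)"

definition consistent :: "nat set \<Rightarrow> nat set \<Rightarrow> bool" where
  "consistent V X \<longleftrightarrow> (\<forall>v\<in>V. \<not> (neg v \<in> X \<and> pos v \<in> X))"

definition edge_imps :: "(nat \<times> nat) set \<Rightarrow> (nat \<times> nat) set" where
  "edge_imps es = (\<Union>(u, v)\<in>es. {(neg u, pos v), (neg v, pos u)})"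

text \<open>Ordered pairs are used, so the contrapositive of each implication is included.\<close>

definition pair_imps :: "nat set \<Rightarrow> (nat \<times> nat) set" where
  "pair_imps B = {(pos u, neg v) | u v. u \<in> B \<and> v \<in> B \<and> u \<noteq> v}"

definition all_imps :: "(nat \<times> nat) set \<Rightarrow> nat set set \<Rightarrow> (nat \<times> nat) set" where
  "all_imps es Bs = edge_imps es \<union> (\<Union>B\<in>Bs. pair_imps B)"

definition solution :: "nat set \<Rightarrow> (nat \<times> nat) set \<Rightarrow> nat set set \<Rightarrow> nat set \<Rightarrow> bool" where
  "solution V es Bs H \<longleftrightarrow> H \<subseteq> V \<and> (\<forall>(u, v)\<in>es. u \<in> H \<or> v \<in> H) \<and>
     (\<forall>B\<in>Bs. \<forall>u\<in>B. \<forall>v\<in>B. u \<in> H \<longrightarrow> v \<in> H \<longrightarrow> u = v)"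

definition closure :: "(nat \<times> nat) set \<Rightarrow> nat set \<Rightarrow> nat set" where
  "closure I S = I\<^sup>* `` S"

lemma closure_subset:
  assumes "S \<subseteq> X" "\<And>a b. (a, b) \<in> I \<Longrightarrow> a \<in> X \<Longrightarrow> b \<in> X"
  shows "closure I S \<subseteq> X"
proof
  fix b assume "b \<in> closure I S"
  then obtain a where "(a, b) \<in> I\<^sup>*" "a \<in> S" by (auto simp: closure_def)
  then show "b \<in> X" by (induction rule: rtrancl_induct) (use assms in auto)
qed

lemma closure_step: "(a, b) \<in> I \<Longrightarrow> a \<in> closure I S \<Longrightarrow> b \<in> closure I S"
  by (auto simp: closure_def intro: rtrancl_into_rtrancl)

lemma subset_closure: "S \<subseteq> closure I S"
  by (auto simp: closure_def)

lemma consistent_mono: "consistent V Y \<Longrightarrow> X \<subseteq> Y \<Longrightarrow> consistent V X"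
  unfolding consistent_def by blast

text \<open>A shortest path repeats no edge and so has at most \<open>card I\<close> of them. The
  slack \<open>K\<close> is for a list of implications with repetitions.\<close>

lemma closure_eq_rounds:
  assumes "finite I" "card I \<le> K"
  shows "closure I S = (\<Union>k\<le>K. (I ^^ k) `` S)"
proof
  show "closure I S \<subseteq> (\<Union>k\<le>K. (I ^^ k) `` S)"
    using assms(2) unfolding closure_def rtrancl_finite_eq_relpow[OF assms(1)] by fastforce
  show "(\<Union>k\<le>K. (I ^^ k) `` S) \<subseteq> closure I S"
    by (auto simp: closure_def intro: relpow_imp_rtrancl)
qed

section \<open>Solutions versus consistent closed sets of literals\<close>

locale two_sat =
  fixes V :: "nat set" and es :: "(nat \<times> nat) set" and Bs :: "nat set set"
  assumes edges: "es \<subseteq> V \<times> V" and sets: "B \<in> Bs \<Longrightarrow> B \<subseteq> V"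
begin

abbreviation I :: "(nat \<times> nat) set" where
  "I \<equiv> all_imps es Bs"

lemma imps_literals: "I \<subseteq> literals V \<times> literals V"
  using edges sets by (fastforce simp: all_imps_def edge_imps_def pair_imps_def literals_def)

lemma closure_literals: "S \<subseteq> literals V \<Longrightarrow> closure I S \<subseteq> literals V"
  using imps_literals by (intro closure_subset) auto

lemma edge_stepD:
  assumes "(u, v) \<in> es"
  shows "neg u \<in> closure I S \<Longrightarrow> pos v \<in> closure I S"
    and "neg v \<in> closure I S \<Longrightarrow> pos u \<in> closure I S"
proof -
  have "(neg u, pos v) \<in> I" "(neg v, pos u) \<in> I"
    using assms unfolding all_imps_def edge_imps_def by blast+
  then show "neg u \<in> closure I S \<Longrightarrow> pos v \<in> closure I S"
    and "neg v \<in> closure I S \<Longrightarrow> pos u \<in> closure I S"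
    by (auto intro: closure_step)
qed

lemma pair_stepD:
  assumes "B \<in> Bs" "u \<in> B" "v \<in> B" "u \<noteq> v"
  shows "pos u \<in> closure I S \<Longrightarrow> neg v \<in> closure I S"
proof (rule closure_step)
  show "(pos u, neg v) \<in> I"
    using assms unfolding all_imps_def pair_imps_def by blast
qed

lemma consistent_truths: "H \<subseteq> V \<Longrightarrow> consistent V (truths V H)"
  by (auto simp: consistent_def truths_def)

text \<open>Every implication is one direction of a clause that the solution satisfies, so truth
  propagates along it.\<close>

lemma closure_truths:
  assumes "solution V es Bs H" "S \<subseteq> truths V H"
  shows "closure I S \<subseteq> truths V H"
proof (rule closure_subset[OF assms(2)])
  have pos: "pos v \<in> truths V H \<longleftrightarrow> v \<in> H" and neg: "neg v \<in> truths V H \<longleftrightarrow> v \<in> V - H" for v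
    by (auto simp: truths_def)
  fix a b assume ab: "(a, b) \<in> I" and a: "a \<in> truths V H"
  from ab consider u v where "(u, v) \<in> es" "(a, b) = (neg u, pos v) \<or> (a, b) = (neg v, pos u)"
    | B u v where "B \<in> Bs" "u \<in> B" "v \<in> B" "u \<noteq> v" "(a, b) = (pos u, neg v)"
    unfolding all_imps_def edge_imps_def pair_imps_def by blast
  then show "b \<in> truths V H"
  proof cases
    case (1 u v)
    have "u \<in> H \<or> v \<in> H" using assms(1) 1(1) unfolding solution_def by blast
    then show ?thesis using 1(2) a pos neg by auto
  next
    case (2 B u v)
    have "\<not> (u \<in> H \<and> v \<in> H)" using assms(1) 2 unfolding solution_def by blast
    moreover have "v \<in> V" using sets[OF 2(1)] 2(3) by blast
    ultimately show ?thesis using 2(5) a pos neg by auto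
  qed
qed

text \<open>A consistent closed set of literals overrides any solution: the clauses it touches
  are satisfied by it, the others by the solution.\<close>

lemma override_solution:
  assumes H: "solution V es Bs H" and S: "S \<subseteq> literals V" "consistent V (closure I S)"
  obtains H' where "solution V es Bs H'" "closure I S \<subseteq> truths V H'"
proof
  let ?X = "closure I S"
  \<comment> \<open>The closure decides every vertex of which it contains a literal, and
    \<open>H\<close> decides the rest.\<close>
  let ?H = "{v \<in> V. pos v \<in> ?X \<or> v \<in> H \<and> neg v \<notin> ?X}"
  have cons: "\<not> (neg v \<in> ?X \<and> pos v \<in> ?X)" if "v \<in> V" for v
    using S(2) that by (auto simp only: consistent_def)
  have "u \<in> ?H \<or> v \<in> ?H" if uv: "(u, v) \<in> es" for u v
  proof -
    have "u \<in> V" "v \<in> V" "u \<in> H \<or> v \<in> H"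
      using uv edges H by (auto simp: solution_def)
    \<comment> \<open>If the closure falsifies one end, it contains the positive literal of the
      other; if it falsifies neither, the end lying in \<open>H\<close> stays.\<close>
    then show ?thesis using edge_stepD[OF uv, of S] cons by blast
  qed
  moreover have "u = v" if B: "B \<in> Bs" "u \<in> B" "v \<in> B" "u \<in> ?H" "v \<in> ?H" for B u v
  proof (rule ccontr)
    assume neq: "u \<noteq> v"
    have "\<not> (u \<in> H \<and> v \<in> H)" using H B neq by (auto simp: solution_def)
    then show False
      using pair_stepD[OF B(1-3) neq, of S] pair_stepD[OF B(1,3,2), of S] neq cons B(4,5) by blast
  qed
  ultimately show "solution V es Bs ?H"
    unfolding solution_def by blast
  show "?X \<subseteq> truths V ?H"
  proof
    fix l assume l: "l \<in> ?X"
    with closure_literals[OF S(1)] have "l \<in> literals V" by blast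
    then consider v where "v \<in> V" "l = pos v" | v where "v \<in> V" "l = neg v"
      unfolding literals_def by blast
    then show "l \<in> truths V ?H"
    proof cases
      case 1
      then show ?thesis using l unfolding truths_def by blast
    next
      case 2
      then have "v \<in> V - ?H" using l cons[of v] by blast
      then show ?thesis unfolding truths_def 2(2) by blast
    qed
  qed
qed

text \<open>Some solution \<open>H'\<close> agrees with all choices so far. The literal of
  \<open>v\<close> that is true in \<open>H'\<close> can be added, since everything implied stays
  inside the consistent set \<open>truths V H'\<close>.\<close>

lemma consistent_extend:
  assumes "solution V es Bs H" "S \<subseteq> literals V" "consistent V (closure I S)" "v \<in> V"
  shows "consistent V (closure I (insert (pos v) S)) \<or> consistent V (closure I (insert (neg v) S))"
proof -
  obtain H' where H': "solution V es Bs H'" "closure I S \<subseteq> truths V H'"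
    using override_solution[OF assms(1-3)] .
  have S: "S \<subseteq> truths V H'" using H'(2) subset_closure by blast
  have cons: "consistent V (closure I T)" if "T \<subseteq> truths V H'" for T
    using consistent_mono[OF consistent_truths closure_truths[OF H'(1) that]] H'(1)
    by (simp add: solution_def)
  show ?thesis
  proof (cases "v \<in> H'")
    case True
    then show ?thesis using S by (intro disjI1 cons) (auto simp: truths_def)
  next
    case False
    then show ?thesis using S assms(4) by (intro disjI2 cons) (auto simp: truths_def)
  qed
qed

text \<open>Totality and consistency turn the closure into a truth assignment, and closedness makes
  it satisfy every clause. Solvability is a conclusion here, so a positive answer is certified by
  the last test alone.\<close>

lemma solution_of_total:
  assumes "\<And>v. v \<in> V \<Longrightarrow> pos v \<in> S \<or> neg v \<in> S" "consistent V (closure I S)"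
  shows "solution V es Bs {v \<in> V. pos v \<in> closure I S}"
proof -
  have total: "pos v \<in> closure I S \<or> neg v \<in> closure I S" if "v \<in> V" for v
    using assms(1)[OF that] subset_closure by blast
  have cons: "\<not> (neg v \<in> closure I S \<and> pos v \<in> closure I S)" if "v \<in> V" for v
    using assms(2) that by (auto simp only: consistent_def)
  let ?H = "{v \<in> V. pos v \<in> closure I S}"
  have "u \<in> ?H \<or> v \<in> ?H" if uv: "(u, v) \<in> es" for u v
  proof -
    have "u \<in> V" "v \<in> V" using uv edges by auto
    then show ?thesis using edge_stepD(1)[OF uv, of S] total[of u] by blast
  qed
  moreover have "u = v" if B: "B \<in> Bs" "u \<in> B" "v \<in> B" "u \<in> ?H" "v \<in> ?H" for B u v
    using pair_stepD[OF B(1-3), of S] cons[of v] B(4,5) by blast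
  ultimately show ?thesis
    unfolding solution_def by blast
qed

end

section \<open>The program\<close>

notation Seq (infixr ";;" 60)

definition nlit :: "aexp \<Rightarrow> aexp" where
  "nlit e = Plus e e"

definition plit :: "aexp \<Rightarrow> aexp" where
  "plit e = Plus (Plus e e) (N 1)"

lemma aval_lit [simp]: "aval (nlit e) s = neg (aval e s)" "aval (plit e) s = pos (aval e s)"
  by (simp_all add: nlit_def plit_def neg_def pos_def)

text \<open>
  Registers: 2, 3, 4 hold the numbers of vertices, edges and sets, 5 points into the input, 6 counts
  implications, 7, 8, 9 are loop counters, 10 is the size of the current set, 11 flags an
  inconsistency and 12 holds the current vertex. Arrays 2 and 3 hold the premises and conclusions of
  the implications, array 4 marks the literals chosen so far and array 5 the literals they imply.
\<close>

definition emit :: "aexp \<Rightarrow> aexp \<Rightarrow> com" where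
  "emit a b = SetArr 2 (R 6) a ;; SetArr 3 (R 6) b ;; SetReg 6 (Plus (R 6) (N 1))"

definition read_edges :: com where
  "read_edges = For 7 3
     (emit (nlit (Get 0 (R 5))) (plit (Get 0 (Plus (R 5) (N 1)))) ;;
      emit (nlit (Get 0 (Plus (R 5) (N 1)))) (plit (Get 0 (R 5))) ;;
      SetReg 5 (Plus (R 5) (N 2)))"

text \<open>Vertices are compared by value and not by position: a set may be listed with
  repetitions, and a vertex must not exclude itself.\<close>

definition read_set :: com where
  "read_set = For 8 10 (For 9 10
     (If (Eq (Get 0 (Plus (R 5) (R 8))) (Get 0 (Plus (R 5) (R 9)))) Skip
       (emit (plit (Get 0 (Plus (R 5) (R 8)))) (nlit (Get 0 (Plus (R 5) (R 9)))))))"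

definition read_sets :: com where
  "read_sets = For 7 4
     ((SetReg 10 (Get 0 (R 5)) ;; SetReg 5 (Plus (R 5) (N 1))) ;; read_set ;;
      SetReg 5 (Plus (R 5) (R 10)))"

text \<open>Zeros are copied too, which erases what an earlier propagation left in array 5.\<close>

definition copy_marks :: com where
  "copy_marks = For 8 2
     (SetReg 12 (Get 0 (Plus (R 8) (N 1))) ;;
      SetArr 5 (nlit (R 12)) (Get 4 (nlit (R 12))) ;;
      SetArr 5 (plit (R 12)) (Get 4 (plit (R 12))))"

definition propagate :: com where
  "propagate = For 8 6 (For 9 6
     (If (Eq (Get 5 (Get 2 (R 9))) (N 1)) (SetArr 5 (Get 3 (R 9)) (N 1)) Skip))"

definition check :: com where
  "check = SetReg 11 (N 0) ;; For 8 2
     (SetReg 12 (Get 0 (Plus (R 8) (N 1))) ;;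
      If (And (Eq (Get 5 (nlit (R 12))) (N 1)) (Eq (Get 5 (plit (R 12))) (N 1)))
        (SetReg 11 (N 1)) Skip)"

definition test :: com where
  "test = copy_marks ;; propagate ;; check"

text \<open>If the negative choice fails as well, the instance is unsolvable, and the test in
  \<open>answer\<close> detects it.\<close>

definition decide_all :: com where
  "decide_all = For 7 2
     (SetArr 4 (plit (Get 0 (Plus (R 7) (N 1)))) (N 1) ;; test ;;
      If (Eq (R 11) (N 1))
        (SetArr 4 (plit (Get 0 (Plus (R 7) (N 1)))) (N 0) ;;
         SetArr 4 (nlit (Get 0 (Plus (R 7) (N 1)))) (N 1))
        Skip)"

definition write_cover :: com where
  "write_cover = For 8 2
     (SetReg 12 (Get 0 (Plus (R 8) (N 1))) ;;
      If (Eq (Get 5 (plit (R 12))) (N 1))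
        (SetArr 1 (R 1) (R 12) ;; SetReg 1 (Plus (R 1) (N 1))) Skip)"

text \<open>The test is repeated because array 5 may still reflect a positive choice that was
  withdrawn.\<close>

definition answer :: com where
  "answer = test ;; SetReg 1 (N 1) ;;
     If (Eq (R 11) (N 1)) (SetArr 1 (N 0) (N 0)) (SetArr 1 (N 0) (N 1) ;; write_cover)"

definition sparse_vc :: com where
  "sparse_vc =
     (SetReg 2 (Get 0 (N 0)) ;; SetReg 3 (Get 0 (Plus (R 2) (N 1))) ;; SetReg 5 (Plus (R 2) (N 2))) ;;
     read_edges ;; (SetReg 4 (Get 0 (R 5)) ;; SetReg 5 (Plus (R 5) (N 1))) ;;
     read_sets ;; decide_all ;; answer"

section \<open>Implication lists in memory and blocks of the input\<close>

definition imps :: "(nat \<Rightarrow> nat) \<Rightarrow> (nat \<Rightarrow> nat) \<Rightarrow> nat \<Rightarrow> (nat \<times> nat) set" where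
  "imps f g k = (\<lambda>i. (f i, g i)) ` {..<k}"

lemma imps_0 [simp]: "imps f g 0 = {}"
  by (simp add: imps_def)

lemma imps_Suc [simp]: "imps (f(k := a)) (g(k := b)) (Suc k) = insert (a, b) (imps f g k)"
  unfolding imps_def lessThan_Suc by auto

text \<open>\<open>pair_imps\<close> with its two arguments separated, to describe a nested loop
  that is only partly done.\<close>

definition cross_imps :: "nat set \<Rightarrow> nat set \<Rightarrow> (nat \<times> nat) set" where
  "cross_imps A B = {(pos u, neg v) | u v. u \<in> A \<and> v \<in> B \<and> u \<noteq> v}"

lemma cross_imps_empty [simp]: "cross_imps {} B = {}" "cross_imps A {} = {}"
  by (simp_all add: cross_imps_def)

lemma cross_imps_insert1: "cross_imps (insert u A) B = cross_imps A B \<union> cross_imps {u} B"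
  by (auto simp: cross_imps_def)

lemma cross_imps_insert2:
  "cross_imps {u} (insert v B) =
     (if u = v then cross_imps {u} B else insert (pos u, neg v) (cross_imps {u} B))"
  by (auto simp: cross_imps_def)

lemma pair_imps_eq: "pair_imps B = cross_imps B B"
  by (simp add: pair_imps_def cross_imps_def)

lemma edge_imps_insert:
  "edge_imps (insert (u, v) es) = insert (neg v, pos u) (insert (neg u, pos v) (edge_imps es))"
  by (auto simp: edge_imps_def)

lemma all_imps_insert: "all_imps es (insert B Bs) = all_imps es Bs \<union> pair_imps B"
  by (auto simp: all_imps_def)

lemma set_take_Suc: "j < length xs \<Longrightarrow> set (take (Suc j) xs) = insert (xs ! j) (set (take j xs))"
  by (simp add: take_Suc_conv_app_nth)

text \<open>Edges and sets are both stored as concatenated blocks; \<open>A\<close> and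
  \<open>C\<close> are what surrounds them in the input.\<close>

lemma nth_concat_map:
  assumes "j < length xs" "i < length (f (xs ! j))"
  shows "length A + length (concat (map f (take j xs))) + i < length (A @ concat (map f xs) @ C)"
    and "(A @ concat (map f xs) @ C) ! (length A + length (concat (map f (take j xs))) + i) = f (xs ! j) ! i"
proof -
  have "concat (map f xs) =
      concat (map f (take j xs)) @ f (xs ! j) @ concat (map f (drop (Suc j) xs))"
    by (subst id_take_nth_drop[OF assms(1)]) simp
  with assms(2)
  show "length A + length (concat (map f (take j xs))) + i < length (A @ concat (map f xs) @ C)"
    and "(A @ concat (map f xs) @ C) ! (length A + length (concat (map f (take j xs))) + i) = f (xs ! j) ! i"
    by (simp_all add: nth_append del: length_concat)
qed

lemma length_concat_pairs [simp]: "length (concat (map (\<lambda>(u, v). [u, v]) es)) = 2 * length es"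
  by (induction es) auto

lemma length_concat_sets:
  "length bs \<le> length (concat (map (\<lambda>b. length b # b) bs))"
  "b \<in> set bs \<Longrightarrow> length b \<le> length (concat (map (\<lambda>b. length b # b) bs))"
  by (induction bs) auto

section \<open>Verification of the program\<close>

locale encoded =
  fixes vs :: "nat list" and es :: "(nat \<times> nat) list" and bs :: "nat list list"
  assumes edges_vs: "set es \<subseteq> set vs \<times> set vs" and sets_vs: "b \<in> set bs \<Longrightarrow> set b \<subseteq> set vs"
begin

sublocale two_sat "set vs" "set es" "set ` set bs"
  using edges_vs sets_vs by unfold_locales auto

section \<open>Addresses in the encoded instance\<close>

abbreviation L :: nat where
  "L \<equiv> length (encode vs es bs)"

text \<open>The initial array \<open>0\<close> as a total function, with the zeros that
  \<open>init_state\<close> puts beyond the input.\<close>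

definition cell :: "nat \<Rightarrow> nat" where
  "cell i = (if i < L then encode vs es bs ! i else 0)"

text \<open>The address of the size of set \<open>j\<close>. The \<open>3\<close> counts the cells
  for the lengths of the three lists.\<close>

definition offset :: "nat \<Rightarrow> nat" where
  "offset j = length vs + 3 + 2 * length es + length (concat (map (\<lambda>b. length b # b) (take j bs)))"

lemma length_le: "length vs \<le> L" "length es \<le> L" "length bs \<le> L" "b \<in> set bs \<Longrightarrow> length b \<le> L"
  using length_concat_sets[where bs = bs] length_concat_pairs[of es]
  by (fastforce simp: encode_def simp del: length_concat)+

lemma cell_num_vertices: "cell 0 = length vs"
  by (simp add: cell_def encode_def)

lemma cell_vertex: "i < length vs \<Longrightarrow> cell (Suc i) = vs ! i"
  by (simp add: cell_def encode_def nth_append)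

lemma cell_num_edges: "cell (Suc (length vs)) = length es"
  by (simp add: cell_def encode_def nth_append)

lemma cell_edge:
  assumes "j < length es"
  shows "cell (length vs + 2 + 2 * j) = fst (es ! j)"
    and "cell (Suc (length vs + 2 + 2 * j)) = snd (es ! j)"
proof -
  let ?f = "\<lambda>(u :: nat, v). [u, v]"
  let ?A = "length vs # vs @ [length es]"
  let ?C = "length bs # concat (map (\<lambda>b. length b # b) bs)"
  have x: "encode vs es bs = ?A @ concat (map ?f es) @ ?C"
    by (simp add: encode_def)
  have len: "length (?f (es ! j)) = 2" by (simp split: prod.split)
  have pre: "length (concat (map ?f (take j es))) = 2 * j"
    unfolding length_concat_pairs using assms by simp
  have "length vs + 2 + 2 * j + i < L \<and> encode vs es bs ! (length vs + 2 + 2 * j + i) = ?f (es ! j) ! i"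
    if "i < 2" for i
    using nth_concat_map[of j es i ?f ?A ?C, OF assms] that unfolding len pre x by simp
  from this[of 0] this[of 1] show "cell (length vs + 2 + 2 * j) = fst (es ! j)"
    "cell (Suc (length vs + 2 + 2 * j)) = snd (es ! j)"
    by (auto simp: cell_def split: prod.split)
qed

lemma offset_0: "offset 0 = length vs + 3 + 2 * length es"
  by (simp add: offset_def)

lemma offset_Suc: "j < length bs \<Longrightarrow> offset (Suc j) = offset j + 1 + length (bs ! j)"
  by (simp add: offset_def take_Suc_conv_app_nth)

lemma cell_num_sets: "cell (length vs + 2 + 2 * length es) = length bs"
proof -
  let ?A = "length vs # vs @ length es # concat (map (\<lambda>(u, v). [u, v]) es)"
  have x: "encode vs es bs = ?A @ length bs # concat (map (\<lambda>b. length b # b) bs)"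
    by (simp add: encode_def)
  have A: "length ?A = length vs + 2 + 2 * length es"
    using length_concat_pairs[of es] by (simp del: length_concat)
  have "length ?A < L"
    unfolding x by (simp del: length_concat)
  moreover have "encode vs es bs ! length ?A = length bs"
    unfolding x by (rule nth_append_length)
  ultimately show ?thesis
    unfolding cell_def A by simp
qed

lemma cell_set:
  assumes "j < length bs"
  shows "cell (offset j) = length (bs ! j)"
    and "i < length (bs ! j) \<Longrightarrow> cell (Suc (offset j + i)) = bs ! j ! i"
proof -
  let ?f = "\<lambda>b :: nat list. length b # b"
  let ?A = "length vs # vs @ length es # concat (map (\<lambda>(u, v). [u, v]) es) @ [length bs]"
  have x: "encode vs es bs = ?A @ concat (map ?f bs) @ []"
    by (simp add: encode_def)
  have A: "length ?A + length (concat (map ?f (take j bs))) = offset j"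
    using length_concat_pairs[of es] by (simp add: offset_def del: length_concat)
  have *: "offset j + i < L \<and> encode vs es bs ! (offset j + i) = ?f (bs ! j) ! i"
    if "i < Suc (length (bs ! j))" for i
    using nth_concat_map[of j bs i ?f ?A "[]", OF assms, folded x, unfolded A] that by simp
  show "cell (offset j) = length (bs ! j)"
    using *[of 0] by (simp add: cell_def)
  show "cell (Suc (offset j + i)) = bs ! j ! i" if "i < length (bs ! j)"
    using *[of "Suc i"] that by (simp add: cell_def)
qed

section \<open>Generating the implications\<close>

abbreviation imps_of :: "state \<Rightarrow> (nat \<times> nat) set" where
  "imps_of s \<equiv> imps (arrs s 2) (arrs s 3) (regs s 6)"

text \<open>Array 4 is kept at zero so that the vertices are later decided starting from the empty
  choice.\<close>

definition reading :: "state \<Rightarrow> bool" where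
  "reading s \<longleftrightarrow> arrs s 0 = cell \<and> regs s 2 = length vs \<and> arrs s 4 = (\<lambda>_. 0)"

lemma tri_read_edges:
  assumes "reading s" "regs s 3 = length es" "regs s 5 = length vs + 2" "regs s 6 = 0"
  shows "tri read_edges s (L * 9 + 2) (\<lambda>s. reading s \<and> regs s 5 = length vs + 2 + 2 * length es \<and>
    regs s 6 \<le> 2 * length es \<and> imps_of s = all_imps (set es) {})"
proof -
  define P where "P j s \<longleftrightarrow> reading s \<and> regs s 7 = j \<and> regs s 3 = length es \<and>
    regs s 5 = length vs + 2 + 2 * j \<and> regs s 6 \<le> 2 * j \<and>
    imps_of s = edge_imps (set (take j es))" for j s
  have "tri read_edges s (L * (7 + 2) + 2) (P (length es))"
    unfolding read_edges_def
  proof (rule tri_For)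
    show "P 0 (s\<lparr>regs := (regs s)(7 := 0)\<rparr>)"
      using assms by (simp add: P_def reading_def edge_imps_def)
    show "regs s 7 = j \<and> regs s 3 = length es" if "P j s" for j s
      using that by (simp add: P_def)
    fix j s assume j: "j < length es" and P: "P j s"
    have e: "edge_imps (set (take (Suc j) es)) =
      insert (neg (snd (es ! j)), pos (fst (es ! j)))
        (insert (neg (fst (es ! j)), pos (snd (es ! j))) (edge_imps (set (take j es))))"
      unfolding set_take_Suc[OF j] by (cases "es ! j") (simp add: edge_imps_insert)
    show "tri (emit (nlit (Get 0 (R 5))) (plit (Get 0 (Plus (R 5) (N 1)))) ;;
        emit (nlit (Get 0 (Plus (R 5) (N 1)))) (plit (Get 0 (R 5))) ;;
        SetReg 5 (Plus (R 5) (N 2))) s 7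
      (\<lambda>s'. P (Suc j) (s'\<lparr>regs := (regs s')(7 := Suc (regs s' 7))\<rparr>))"
      using P cell_edge[OF j] by (intro tri_run) (simp_all add: P_def reading_def emit_def e)
  qed (rule length_le)
  then show ?thesis
    by (rule tri_weaken) (auto simp: P_def all_imps_def)
qed

end

context encoded
begin

text \<open>The preserved registers are those on which the enclosing loop relies. Each ordered pair
  of positions emits at most one implication, hence \<open>L * L\<close>.\<close>

lemma tri_read_set:
  assumes b: "b \<in> set bs" and s: "reading s" "regs s 10 = length b"
    and cells: "\<And>i. i < length b \<Longrightarrow> cell (regs s 5 + i) = b ! i"
  shows "tri read_set s (L * (L * 7 + 4) + 2) (\<lambda>s'. reading s' \<and>
    (\<forall>r\<in>{4, 5, 7, 10}. regs s' r = regs s r) \<and> regs s' 6 \<le> regs s 6 + L * L \<and>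
    imps_of s' = imps_of s \<union> pair_imps (set b))"
proof -
  have bL: "length b \<le> L" using b by (rule length_le)
  define Q where "Q a s' \<longleftrightarrow> reading s' \<and> (\<forall>r\<in>{4, 5, 7, 10}. regs s' r = regs s r) \<and>
    regs s' 8 = a \<and> regs s' 6 \<le> regs s 6 + a * L \<and>
    imps_of s' = imps_of s \<union> cross_imps (set (take a b)) (set b)" for a s'
  define P where "P a i s' \<longleftrightarrow> reading s' \<and> (\<forall>r\<in>{4, 5, 7, 10}. regs s' r = regs s r) \<and>
    regs s' 8 = a \<and> regs s' 9 = i \<and> regs s' 6 \<le> regs s 6 + a * L + i \<and>
    imps_of s' = imps_of s \<union> cross_imps (set (take a b)) (set b) \<union>
      cross_imps {b ! a} (set (take i b))" for a i s'
  have inner: "tri (For 9 10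
     (If (Eq (Get 0 (Plus (R 5) (R 8))) (Get 0 (Plus (R 5) (R 9)))) Skip
       (emit (plit (Get 0 (Plus (R 5) (R 8)))) (nlit (Get 0 (Plus (R 5) (R 9)))))))
     s' (L * (5 + 2) + 2) (P a (length b))"
    if a: "a < length b" and Q: "Q a s'" for a s'
  proof (rule tri_For)
    show "P a 0 (s'\<lparr>regs := (regs s')(9 := 0)\<rparr>)"
      using Q by (simp add: P_def Q_def reading_def)
    show "regs t 9 = i \<and> regs t 10 = length b" if "P a i t" for i t
      using that s by (simp add: P_def)
    fix i t assume i: "i < length b" and P: "P a i t"
    show "tri (If (Eq (Get 0 (Plus (R 5) (R 8))) (Get 0 (Plus (R 5) (R 9)))) Skip
       (emit (plit (Get 0 (Plus (R 5) (R 8)))) (nlit (Get 0 (Plus (R 5) (R 9)))))) t 5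
      (\<lambda>s'. P a (Suc i) (s'\<lparr>regs := (regs s')(9 := Suc (regs s' 9))\<rparr>))"
      using P cells[OF a] cells[OF i]
      by (intro tri_run)
        (simp_all add: P_def reading_def emit_def set_take_Suc[OF i] cross_imps_insert2)
  qed (rule bL)
  have "tri read_set s (L * ((L * (5 + 2) + 2) + 2) + 2) (Q (length b))"
    unfolding read_set_def
  proof (rule tri_For)
    show "Q 0 (s\<lparr>regs := (regs s)(8 := 0)\<rparr>)"
      using s by (simp add: Q_def reading_def)
    show "regs t 8 = a \<and> regs t 10 = length b" if "Q a t" for a t
      using that s by (simp add: Q_def)
    fix a t assume a: "a < length b" and Q: "Q a t"
    show "tri (For 9 10
     (If (Eq (Get 0 (Plus (R 5) (R 8))) (Get 0 (Plus (R 5) (R 9)))) Skip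
       (emit (plit (Get 0 (Plus (R 5) (R 8)))) (nlit (Get 0 (Plus (R 5) (R 9)))))))
      t (L * (5 + 2) + 2) (\<lambda>s'. Q (Suc a) (s'\<lparr>regs := (regs s')(8 := Suc (regs s' 8))\<rparr>))"
    proof (rule tri_weaken[OF inner[OF a Q]])
      fix s' assume "P a (length b) s'"
      then show "Q (Suc a) (s'\<lparr>regs := (regs s')(8 := Suc (regs s' 8))\<rparr>)"
        using bL
        by (simp add: P_def Q_def reading_def set_take_Suc[OF a] Un_assoc
          cross_imps_insert1[of "b ! a" "set (take a b)"])
    qed simp
  qed (rule bL)
  then show ?thesis
  proof (rule tri_weaken)
    fix s' assume Q: "Q (length b) s'"
    have "regs s' 6 \<le> regs s 6 + length b * L" using Q by (simp only: Q_def)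
    also have "\<dots> \<le> regs s 6 + L * L" using bL by (intro add_left_mono mult_le_mono1)
    finally show "reading s' \<and> (\<forall>r\<in>{4, 5, 7, 10}. regs s' r = regs s r) \<and>
      regs s' 6 \<le> regs s 6 + L * L \<and> imps_of s' = imps_of s \<union> pair_imps (set b)"
      using Q by (simp add: Q_def pair_imps_eq)
  qed (simp add: algebra_simps)
qed

text \<open>Two implications per edge, and at most \<open>L * L\<close> for each of at most
  \<open>L\<close> sets.\<close>

abbreviation K :: nat where
  "K \<equiv> 2 * L + L * (L * L)"

lemma tri_read_sets:
  assumes "reading s" "regs s 4 = length bs" "regs s 5 = offset 0" "regs s 6 \<le> 2 * L"
    "imps_of s = all_imps (set es) {}"
  shows "tri read_sets s (L * (L * (L * 7 + 4) + 7) + 2) (\<lambda>s. reading s \<and> regs s 6 \<le> K \<and>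
    imps_of s = I)"
proof -
  define P where "P j s \<longleftrightarrow> reading s \<and> regs s 7 = j \<and> regs s 4 = length bs \<and>
    regs s 5 = offset j \<and> regs s 6 \<le> 2 * L + j * (L * L) \<and>
    imps_of s = all_imps (set es) (set ` set (take j bs))" for j s
  have "tri read_sets s (L * ((2 + ((L * (L * 7 + 4) + 2) + 1)) + 2) + 2) (P (length bs))"
    unfolding read_sets_def
  proof (rule tri_For)
    show "P 0 (s\<lparr>regs := (regs s)(7 := 0)\<rparr>)"
      using assms by (simp add: P_def reading_def)
    show "regs s 7 = j \<and> regs s 4 = length bs" if "P j s" for j s
      using that by (simp add: P_def)
    fix j s assume j: "j < length bs" and P: "P j s"
    let ?b = "bs ! j"
    have b: "?b \<in> set bs" using j by simp
    \<comment> \<open>This state gets a name because the postcondition of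
      \<open>tri_read_set\<close> refers to its start state.\<close>
    let ?s1 = "run (SetReg 10 (Get 0 (R 5)) ;; SetReg 5 (Plus (R 5) (N 1))) s"
    have s1: "reading ?s1" "regs ?s1 10 = length ?b" "regs ?s1 7 = j" "regs ?s1 4 = length bs"
      "regs ?s1 5 = Suc (offset j)" "regs ?s1 6 \<le> 2 * L + j * (L * L)"
      "imps_of ?s1 = all_imps (set es) (set ` set (take j bs))"
      using P cell_set(1)[OF j] by (simp_all add: P_def reading_def)
    show "tri ((SetReg 10 (Get 0 (R 5)) ;; SetReg 5 (Plus (R 5) (N 1))) ;; read_set ;;
        SetReg 5 (Plus (R 5) (R 10))) s (2 + ((L * (L * 7 + 4) + 2) + 1))
      (\<lambda>s'. P (Suc j) (s'\<lparr>regs := (regs s')(7 := Suc (regs s' 7))\<rparr>))"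
    proof (rule tri_Seq[where P = "\<lambda>s'. s' = ?s1"])
      show "tri (SetReg 10 (Get 0 (R 5)) ;; SetReg 5 (Plus (R 5) (N 1))) s 2 (\<lambda>s'. s' = ?s1)"
        by (rule tri_run) simp_all
      fix s' assume s': "s' = ?s1"
      show "tri (read_set ;; SetReg 5 (Plus (R 5) (R 10))) s' ((L * (L * 7 + 4) + 2) + 1)
        (\<lambda>s'. P (Suc j) (s'\<lparr>regs := (regs s')(7 := Suc (regs s' 7))\<rparr>))"
        unfolding s'
      proof (rule tri_Seq[OF tri_read_set[OF b s1(1,2)]])
        show "cell (regs ?s1 5 + i) = ?b ! i" if "i < length ?b" for i
          using cell_set(2)[OF j that] s1(5) by (simp del: run.simps)
        fix t assume t: "reading t \<and> (\<forall>r\<in>{4, 5, 7, 10}. regs t r = regs ?s1 r) \<and>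
          regs t 6 \<le> regs ?s1 6 + L * L \<and> imps_of t = imps_of ?s1 \<union> pair_imps (set ?b)"
        have 4: "regs t 4 = length bs" and 5: "regs t 5 = Suc (offset j)" and 7: "regs t 7 = j"
          and 10: "regs t 10 = length ?b" and 6: "regs t 6 \<le> 2 * L + j * (L * L) + L * L"
          and imps: "imps_of t = all_imps (set es) (set ` set (take j bs)) \<union> pair_imps (set ?b)"
          using t s1 by (auto simp del: run.simps)
        show "tri (SetReg 5 (Plus (R 5) (R 10))) t 1
          (\<lambda>s'. P (Suc j) (s'\<lparr>regs := (regs s')(7 := Suc (regs s' 7))\<rparr>))"
          using conjunct1[OF t] 4 5 7 10 6 imps
          by (intro tri_run) (simp_all add: P_def reading_def offset_Suc[OF j]
            set_take_Suc[OF j] all_imps_insert)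
      qed
    qed
  qed (rule length_le)
  then show ?thesis
  proof (rule tri_weaken)
    fix s assume P: "P (length bs) s"
    have "regs s 6 \<le> 2 * L + length bs * (L * L)" using P by (simp only: P_def)
    also have "\<dots> \<le> K" using length_le(3) by (intro add_left_mono mult_le_mono1)
    finally show "reading s \<and> regs s 6 \<le> K \<and> imps_of s = I"
      using P by (simp add: P_def)
  qed (simp add: algebra_simps)
qed

end

text \<open>The time bounds are polymorphic so that they can be evaluated at numbers and at the
  polynomial \<open>[:0, 1:]\<close> alike.\<close>

definition imp_bound :: "'a::comm_semiring_1 \<Rightarrow> 'a" where
  "imp_bound l = 2 * l + l * (l * l)"

definition test_time :: "'a::comm_semiring_1 \<Rightarrow> 'a" where
  "test_time l = (l * 5 + 2) + ((imp_bound l * (imp_bound l * 5 + 4) + 2) + (l * 6 + 3))"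

section \<open>Propagation and the consistency test\<close>

context encoded
begin

text \<open>The frame condition of a test: only scratch registers and array 5 change, so the choices
  in array 4 and the outer counter in register 7 survive.\<close>

definition keeps :: "state \<Rightarrow> state \<Rightarrow> bool" where
  "keeps s s' \<longleftrightarrow> (\<forall>r. r \<notin> {8, 9, 11, 12} \<longrightarrow> regs s' r = regs s r) \<and>
     (\<forall>a. a \<noteq> 5 \<longrightarrow> arrs s' a = arrs s a)"

lemma keeps_refl [simp]: "keeps s s"
  by (simp add: keeps_def)

lemma keeps_trans: "keeps s t \<Longrightarrow> keeps t u \<Longrightarrow> keeps s u"
  by (simp add: keeps_def)

lemma keepsD:
  assumes "keeps s s'"
  shows "regs s' 1 = regs s 1" "regs s' 2 = regs s 2" "regs s' 6 = regs s 6" "regs s' 7 = regs s 7"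
    "arrs s' 0 = arrs s 0" "arrs s' 1 = arrs s 1" "arrs s' 2 = arrs s 2" "arrs s' 3 = arrs s 3"
    "arrs s' 4 = arrs s 4"
  using assms by (simp_all add: keeps_def)

definition ready :: "state \<Rightarrow> bool" where
  "ready s \<longleftrightarrow> arrs s 0 = cell \<and> regs s 2 = length vs \<and> regs s 6 \<le> K \<and> imps_of s = I"

lemma ready_keeps: "ready s \<Longrightarrow> keeps s s' \<Longrightarrow> ready s'"
  by (simp add: ready_def keepsD)

text \<open>Restricted to literals of the instance, since \<open>copy_marks\<close> transfers only
  their cells.\<close>

definition marked :: "(nat \<Rightarrow> nat) \<Rightarrow> nat set" where
  "marked f = {l \<in> literals (set vs). f l = 1}"

lemma marked_literals: "marked f \<subseteq> literals (set vs)"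
  by (auto simp: marked_def)

lemma literals_nth: "j < length vs \<Longrightarrow> pos (vs ! j) \<in> literals (set vs)"
  "j < length vs \<Longrightarrow> neg (vs ! j) \<in> literals (set vs)"
  by (simp_all add: literals_def)

lemma marked_upd_1: "l \<in> literals (set vs) \<Longrightarrow> marked (f(l := 1)) = insert l (marked f)"
  by (auto simp: marked_def)

lemma marked_upd_0: "marked (f(l := 0)) = marked f - {l}"
  by (auto simp: marked_def)

lemma tri_copy_marks:
  assumes "ready s"
  shows "tri copy_marks s (L * 5 + 2) (\<lambda>s'. keeps s s' \<and> marked (arrs s' 5) = marked (arrs s 4))"
proof -
  define P where "P j s' \<longleftrightarrow> keeps s s' \<and> regs s' 8 = j \<and>
    (\<forall>v\<in>set (take j vs). arrs s' 5 (neg v) = arrs s 4 (neg v) \<and> arrs s' 5 (pos v) = arrs s 4 (pos v))"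
    for j s'
  have s: "arrs s 0 = cell" "regs s 2 = length vs"
    using assms by (simp_all add: ready_def)
  have "tri copy_marks s (L * (3 + 2) + 2) (P (length vs))"
    unfolding copy_marks_def
  proof (rule tri_For)
    show "P 0 (s\<lparr>regs := (regs s)(8 := 0)\<rparr>)"
      by (simp add: P_def keeps_def)
    show "regs t 8 = j \<and> regs t 2 = length vs" if "P j t" for j t
      using that s by (auto simp: P_def dest: keepsD(2))
    fix j t assume j: "j < length vs" and P: "P j t"
    show "tri (SetReg 12 (Get 0 (Plus (R 8) (N 1))) ;;
        SetArr 5 (nlit (R 12)) (Get 4 (nlit (R 12))) ;;
        SetArr 5 (plit (R 12)) (Get 4 (plit (R 12)))) t 3
      (\<lambda>s'. P (Suc j) (s'\<lparr>regs := (regs s')(8 := Suc (regs s' 8))\<rparr>))"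
      using P s cell_vertex[OF j]
      by (intro tri_run) (auto simp: P_def keeps_def set_take_Suc[OF j])
  qed (rule length_le)
  then show ?thesis
    by (rule tri_weaken) (auto simp: P_def marked_def literals_def)
qed

text \<open>Marks set early in a sweep are seen later in the same sweep, so the marked set is not
  tracked exactly. It is caught between what is reachable in at most \<open>j\<close> steps and the
  full closure; after as many sweeps as implications the two bounds coincide.\<close>

lemma tri_propagate:
  assumes "ready s"
  shows "tri propagate s (K * (K * 5 + 4) + 2)
    (\<lambda>s'. keeps s s' \<and> marked (arrs s' 5) = closure I (marked (arrs s 5)))"
proof -
  let ?k = "regs s 6" and ?X = "\<lambda>t. marked (arrs t 5)"
  have k: "?k \<le> K" and I: "(\<lambda>i. (arrs s 2 i, arrs s 3 i)) ` {..<?k} = I"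
    using assms by (simp_all add: ready_def imps_def)
  have imp: "(arrs s 2 i, arrs s 3 i) \<in> I" if "i < ?k" for i
    using that I by blast
  define Q where "Q j t \<longleftrightarrow> keeps s t \<and> regs t 8 = j \<and>
    (\<Union>i\<le>j. (I ^^ i) `` ?X s) \<subseteq> ?X t \<and> ?X t \<subseteq> closure I (?X s)" for j t
  \<comment> \<open>\<open>Y\<close> freezes the marks at the start of the sweep; only premises in
    \<open>Y\<close> are promised to have fired.\<close>
  define P where "P j Y i t \<longleftrightarrow> keeps s t \<and> regs t 8 = j \<and> regs t 9 = i \<and> Y \<subseteq> ?X t \<and>
    (\<forall>h<i. arrs s 2 h \<in> Y \<longrightarrow> arrs s 3 h \<in> ?X t) \<and> ?X t \<subseteq> closure I (?X s)" for j Y i t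
  have inner: "tri (For 9 6
     (If (Eq (Get 5 (Get 2 (R 9))) (N 1)) (SetArr 5 (Get 3 (R 9)) (N 1)) Skip))
     t (K * (3 + 2) + 2) (P j (?X t) ?k)" if Q: "Q j t" for j t
  proof (rule tri_For)
    show "P j (?X t) 0 (t\<lparr>regs := (regs t)(9 := 0)\<rparr>)"
      using Q by (simp add: P_def Q_def keeps_def)
    show "regs u 9 = i \<and> regs u 6 = ?k" if "P j (?X t) i u" for i u
      using that by (simp add: P_def keepsD)
    fix i u assume i: "i < ?k" and P: "P j (?X t) i u"
    have lits: "arrs s 2 i \<in> literals (set vs)" "arrs s 3 i \<in> literals (set vs)"
      using imp[OF i] imps_literals by auto
    have u: "keeps s u" "regs u 9 = i" "regs u 8 = j" "?X t \<subseteq> ?X u" "?X u \<subseteq> closure I (?X s)"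
      "arrs u 2 = arrs s 2" "arrs u 3 = arrs s 3"
      "\<And>h. h < i \<Longrightarrow> arrs s 2 h \<in> ?X t \<Longrightarrow> arrs s 3 h \<in> ?X u"
      using P by (simp_all add: P_def keepsD)
    have "P j (?X t) (Suc i) (u\<lparr>arrs := (arrs u)(5 := (arrs u 5)(arrs s 3 i := 1)),
        regs := (regs u)(9 := Suc (regs u 9))\<rparr>)"
      if "arrs s 2 i \<in> ?X u"
    proof -
      have "arrs s 3 i \<in> closure I (?X s)"
        using closure_step[OF imp[OF i]] that u(5) by blast
      then show ?thesis
        using u(1-5,8) by (auto simp: P_def keeps_def marked_upd_1[OF lits(2)] less_Suc_eq simp del: One_nat_def)
    qed
    moreover have "P j (?X t) (Suc i) (u\<lparr>regs := (regs u)(9 := Suc (regs u 9))\<rparr>)"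
      if "arrs s 2 i \<notin> ?X u"
      using that u(1-5,8) by (auto simp: P_def keeps_def less_Suc_eq)
    moreover have "arrs u 5 (arrs s 2 i) = 1 \<longleftrightarrow> arrs s 2 i \<in> ?X u"
      using lits(1) by (simp add: marked_def)
    ultimately show "tri (If (Eq (Get 5 (Get 2 (R 9))) (N 1)) (SetArr 5 (Get 3 (R 9)) (N 1)) Skip) u 3
      (\<lambda>s'. P j (?X t) (Suc i) (s'\<lparr>regs := (regs s')(9 := Suc (regs s' 9))\<rparr>))"
      using u(2,6,7) by (intro tri_run) auto
  qed (rule k)
  have "tri propagate s (K * ((K * (3 + 2) + 2) + 2) + 2) (Q ?k)"
    unfolding propagate_def
  proof (rule tri_For)
    show "Q 0 (s\<lparr>regs := (regs s)(8 := 0)\<rparr>)"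
      by (simp add: Q_def keeps_def subset_closure)
    show "regs t 8 = j \<and> regs t 6 = ?k" if "Q j t" for j t
      using that by (simp add: Q_def keepsD)
    fix j t assume "j < ?k" and Q: "Q j t"
    show "tri (For 9 6 (If (Eq (Get 5 (Get 2 (R 9))) (N 1)) (SetArr 5 (Get 3 (R 9)) (N 1)) Skip))
      t (K * (3 + 2) + 2) (\<lambda>s'. Q (Suc j) (s'\<lparr>regs := (regs s')(8 := Suc (regs s' 8))\<rparr>))"
    proof (rule tri_weaken[OF inner[OF Q]])
      fix s' assume P: "P j (?X t) ?k s'"
      have step: "b \<in> ?X s'" if "(a, b) \<in> I" "a \<in> ?X t" for a b
        using that P unfolding I[symmetric] by (auto simp: P_def)
      have "(I ^^ i) `` ?X s \<subseteq> ?X s'" if "i \<le> Suc j" for i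
      proof (cases "i = Suc j")
        case True
        have "(I ^^ j) `` ?X s \<subseteq> ?X t" using Q by (auto simp: Q_def)
        then show ?thesis using step unfolding True by auto
      next
        case False
        then have "i \<le> j" using that by simp
        then have "(I ^^ i) `` ?X s \<subseteq> ?X t" using Q unfolding Q_def by blast
        then show ?thesis using P by (auto simp: P_def)
      qed
      then have "(\<Union>i\<le>Suc j. (I ^^ i) `` ?X s) \<subseteq> ?X s'" by blast
      then show "Q (Suc j) (s'\<lparr>regs := (regs s')(8 := Suc (regs s' 8))\<rparr>)"
        using P by (simp add: P_def Q_def keeps_def)
    qed simp
  qed (rule k)
  then show ?thesis
  proof (rule tri_weaken)
    have "finite I" unfolding I[symmetric] by simp
    \<comment> \<open>The list may repeat implications, so its length is only an upper bound for
      \<open>card I\<close>.\<close>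
    moreover have "card I \<le> ?k" unfolding I[symmetric] using card_image_le[of "{..<?k}"] by simp
    ultimately show "keeps s t \<and> ?X t = closure I (?X s)" if "Q ?k t" for t
      using that closure_eq_rounds[of I ?k "?X s"] by (auto simp: Q_def)
  qed (simp add: algebra_simps)
qed

lemma tri_check:
  assumes "ready s"
  shows "tri check s (L * 6 + 3) (\<lambda>s'. keeps s s' \<and> arrs s' 5 = arrs s 5 \<and>
    regs s' 11 = (if consistent (set vs) (marked (arrs s 5)) then 0 else 1))"
proof -
  define P where "P j s' \<longleftrightarrow> keeps s s' \<and> regs s' 8 = j \<and> arrs s' 5 = arrs s 5 \<and>
    regs s' 11 = (if consistent (set (take j vs)) (marked (arrs s 5)) then 0 else 1)" for j s'
  have s: "arrs s 0 = cell" "regs s 2 = length vs"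
    using assms by (simp_all add: ready_def)
  have "tri check s (1 + (L * (4 + 2) + 2)) (P (length vs))"
    unfolding check_def
  proof (rule tri_Seq[where P = "\<lambda>s'. s' = s\<lparr>regs := (regs s)(11 := 0)\<rparr>"])
    fix s' assume s': "s' = s\<lparr>regs := (regs s)(11 := 0)\<rparr>"
    show "tri (For 8 2 (SetReg 12 (Get 0 (Plus (R 8) (N 1))) ;;
      If (And (Eq (Get 5 (nlit (R 12))) (N 1)) (Eq (Get 5 (plit (R 12))) (N 1)))
        (SetReg 11 (N 1)) Skip)) s' (L * (4 + 2) + 2) (P (length vs))"
    proof (rule tri_For)
      show "P 0 (s'\<lparr>regs := (regs s')(8 := 0)\<rparr>)"
        by (simp add: s' P_def keeps_def consistent_def)
      show "regs t 8 = j \<and> regs t 2 = length vs" if "P j t" for j t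
        using that s by (auto simp: P_def dest: keepsD(2))
      fix j t assume j: "j < length vs" and P: "P j t"
      have "consistent (set (take (Suc j) vs)) (marked (arrs s 5)) \<longleftrightarrow>
          consistent (set (take j vs)) (marked (arrs s 5)) \<and>
          \<not> (arrs s 5 (neg (vs ! j)) = 1 \<and> arrs s 5 (pos (vs ! j)) = 1)"
        using literals_nth[OF j] by (auto simp: consistent_def set_take_Suc[OF j] marked_def)
      then show "tri (SetReg 12 (Get 0 (Plus (R 8) (N 1))) ;;
        If (And (Eq (Get 5 (nlit (R 12))) (N 1)) (Eq (Get 5 (plit (R 12))) (N 1)))
          (SetReg 11 (N 1)) Skip) t 4
        (\<lambda>s'. P (Suc j) (s'\<lparr>regs := (regs s')(8 := Suc (regs s' 8))\<rparr>))"
        using P s cell_vertex[OF j] by (intro tri_run) (simp_all add: P_def keeps_def)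
    qed (rule length_le)
  qed (rule tri_run; simp)
  then show ?thesis
    by (rule tri_weaken) (auto simp: P_def)
qed

lemma tri_test:
  assumes "ready s"
  shows "tri test s (test_time L) (\<lambda>s'. keeps s s' \<and>
    marked (arrs s' 5) = closure I (marked (arrs s 4)) \<and>
    regs s' 11 = (if consistent (set vs) (closure I (marked (arrs s 4))) then 0 else 1))"
  unfolding test_def test_time_def imp_bound_def
proof (rule tri_Seq[OF tri_copy_marks[OF assms]])
  fix t assume t: "keeps s t \<and> marked (arrs t 5) = marked (arrs s 4)"
  then have "ready t" using ready_keeps[OF assms] by simp
  then show "tri (propagate ;; check) t ((K * (K * 5 + 4) + 2) + (L * 6 + 3)) (\<lambda>s'. keeps s s' \<and>
    marked (arrs s' 5) = closure I (marked (arrs s 4)) \<and>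
    regs s' 11 = (if consistent (set vs) (closure I (marked (arrs s 4))) then 0 else 1))"
  proof (rule tri_Seq[OF tri_propagate])
    fix u assume u: "keeps t u \<and> marked (arrs u 5) = closure I (marked (arrs t 5))"
    then have "ready u" using ready_keeps[OF \<open>ready t\<close>] by simp
    from tri_check[OF this] show "tri check u (L * 6 + 3) (\<lambda>s'. keeps s s' \<and>
      marked (arrs s' 5) = closure I (marked (arrs s 4)) \<and>
      regs s' 11 = (if consistent (set vs) (closure I (marked (arrs s 4))) then 0 else 1))"
      by (rule tri_weaken) (use t u in \<open>auto intro: keeps_trans\<close>)
  qed
qed

end

section \<open>Fixing the vertices and writing the answer\<close>

context encoded
begin

abbreviation chosen :: "state \<Rightarrow> nat set" where
  "chosen s \<equiv> marked (arrs s 4)"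

abbreviation solvable :: bool where
  "solvable \<equiv> \<exists>H. solution (set vs) (set es) (set ` set bs) H"

text \<open>Totality holds on every instance, consistency only on solvable ones, where
  \<open>consistent_extend\<close> covers the untested negative choice.\<close>

lemma tri_decide_all:
  assumes "ready s" "chosen s = {}"
  shows "tri decide_all s (L * (test_time L + 7) + 2) (\<lambda>s'. ready s' \<and>
    (\<forall>v\<in>set vs. pos v \<in> chosen s' \<or> neg v \<in> chosen s') \<and>
    (solvable \<longrightarrow> consistent (set vs) (closure I (chosen s'))))"
proof -
  define P where "P j s \<longleftrightarrow> ready s \<and> regs s 7 = j \<and>
    (\<forall>v\<in>set (take j vs). pos v \<in> chosen s \<or> neg v \<in> chosen s) \<and>
    (solvable \<longrightarrow> consistent (set vs) (closure I (chosen s)))" for j s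
  have "tri decide_all s (L * ((1 + (test_time L + 4)) + 2) + 2) (P (length vs))"
    unfolding decide_all_def
  proof (rule tri_For)
    show "P 0 (s\<lparr>regs := (regs s)(7 := 0)\<rparr>)"
      using assms by (simp add: P_def ready_def closure_def consistent_def)
    show "regs s 7 = j \<and> regs s 2 = length vs" if "P j s" for j s
      using that by (simp add: P_def ready_def)
    fix j s assume j: "j < length vs" and P: "P j s"
    define v where "v = vs ! j"
    let ?S = "chosen s"
    have v: "v \<in> set vs" "pos v \<in> literals (set vs)" "neg v \<in> literals (set vs)"
      using j literals_nth[OF j] by (simp_all add: v_def)
    define s1 where "s1 = s\<lparr>arrs := (arrs s)(4 := (arrs s 4)(pos v := 1))\<rparr>"
    have s: "ready s" "regs s 7 = j" "cell (Suc j) = v"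
      using P cell_vertex[OF j] by (simp_all add: P_def v_def)
    then have s1: "ready s1" "regs s1 7 = j" "chosen s1 = insert (pos v) ?S" "arrs s1 4 = (arrs s 4)(pos v := 1)"
      using marked_upd_1[OF v(2)] by (simp_all add: s1_def ready_def)
    show "tri (SetArr 4 (plit (Get 0 (Plus (R 7) (N 1)))) (N 1) ;; test ;;
      If (Eq (R 11) (N 1))
        (SetArr 4 (plit (Get 0 (Plus (R 7) (N 1)))) (N 0) ;;
         SetArr 4 (nlit (Get 0 (Plus (R 7) (N 1)))) (N 1))
        Skip) s (1 + (test_time L + 4))
      (\<lambda>s'. P (Suc j) (s'\<lparr>regs := (regs s')(7 := Suc (regs s' 7))\<rparr>))"
    proof (rule tri_Seq[where P = "\<lambda>s'. s' = s1"])
      show "tri (SetArr 4 (plit (Get 0 (Plus (R 7) (N 1)))) (N 1)) s 1 (\<lambda>s'. s' = s1)"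
        using s by (intro tri_run) (simp_all add: s1_def ready_def)
      fix s' assume s': "s' = s1"
      show "tri (test ;;
        If (Eq (R 11) (N 1))
          (SetArr 4 (plit (Get 0 (Plus (R 7) (N 1)))) (N 0) ;;
           SetArr 4 (nlit (Get 0 (Plus (R 7) (N 1)))) (N 1))
          Skip) s' (test_time L + 4)
        (\<lambda>s'. P (Suc j) (s'\<lparr>regs := (regs s')(7 := Suc (regs s' 7))\<rparr>))"
        unfolding s'
      proof (rule tri_Seq[OF tri_test[OF s1(1)]])
        fix t assume t: "keeps s1 t \<and> marked (arrs t 5) = closure I (chosen s1) \<and>
          regs t 11 = (if consistent (set vs) (closure I (chosen s1)) then 0 else 1)"
        have t4: "arrs t 4 = (arrs s 4)(pos v := 1)" and t7: "regs t 7 = j" and "ready t"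
          using t s1 ready_keeps[of s1 t] by (auto dest: keepsD)
        have cell: "cell (Suc (regs t 7)) = v" "arrs t 0 = cell"
          using s(3) t7 \<open>ready t\<close> by (simp_all add: ready_def)
        \<comment> \<open>A vertex may be listed repeatedly, so \<open>pos v\<close> may be an older
          mark that is now withdrawn. Its loss does no damage, as \<open>X\<close> contains a
          literal of \<open>v\<close> anyway.\<close>
        have total: "\<forall>u\<in>set (take (Suc j) vs). pos u \<in> X \<or> neg u \<in> X"
          if "?S - {pos v} \<subseteq> X" "pos v \<in> X \<or> neg v \<in> X" for X
        proof -
          have "pos u \<in> X \<or> neg u \<in> X" if "u \<in> set (take j vs)" for u
          proof -
            have "pos u \<in> ?S \<or> neg u \<in> ?S" using P that by (simp add: P_def)
            then show ?thesis
              using \<open>?S - {pos v} \<subseteq> X\<close> \<open>pos v \<in> X \<or> neg v \<in> X\<close> by (cases "u = v") auto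
          qed
          then show ?thesis
            using that(2) by (simp add: set_take_Suc[OF j] v_def)
        qed
        show "tri (If (Eq (R 11) (N 1))
            (SetArr 4 (plit (Get 0 (Plus (R 7) (N 1)))) (N 0) ;;
             SetArr 4 (nlit (Get 0 (Plus (R 7) (N 1)))) (N 1))
            Skip) t 4
          (\<lambda>s'. P (Suc j) (s'\<lparr>regs := (regs s')(7 := Suc (regs s' 7))\<rparr>))"
        proof (cases "consistent (set vs) (closure I (insert (pos v) ?S))")
          case True
          have "marked ((arrs s 4)(pos v := 1)) = insert (pos v) ?S"
            by (rule marked_upd_1[OF v(2)])
          then have "P (Suc j) (t\<lparr>regs := (regs t)(7 := Suc (regs t 7))\<rparr>)"
            using True \<open>ready t\<close> t7 total[of "insert (pos v) ?S"]
            by (auto simp: P_def ready_def t4)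
          then show ?thesis
            using True t s1(3) by (intro tri_run) simp_all
        next
          case False
          let ?f = "(arrs s 4)(pos v := 0, neg v := 1)"
          have f: "marked ?f = insert (neg v) (?S - {pos v})"
            by (simp only: marked_upd_1[OF v(3)] marked_upd_0)
          have "consistent (set vs) (closure I (insert (neg v) (?S - {pos v})))" if "solvable"
          proof -
            have cons: "consistent (set vs) (closure I ?S)" using P that by (simp add: P_def)
            \<comment> \<open>Otherwise adding \<open>pos v\<close> would have changed nothing and
              the closure would have stayed consistent.\<close>
            with False have "pos v \<notin> ?S" by (auto simp: insert_absorb)
            moreover have "consistent (set vs) (closure I (insert (neg v) ?S))"
              using that consistent_extend[OF _ marked_literals cons v(1)] False by blast
            ultimately show ?thesis by simp
          qed
          moreover have "\<forall>u\<in>set (take (Suc j) vs). pos u \<in> marked ?f \<or> neg u \<in> marked ?f"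
            unfolding f by (rule total) auto
          ultimately have "P (Suc j) (t\<lparr>arrs := (arrs t)(4 := ?f), regs := (regs t)(7 := Suc (regs t 7))\<rparr>)"
            using \<open>ready t\<close> t7 by (simp add: P_def ready_def f del: One_nat_def)
          then show ?thesis
            using False t s1(3) t4 cell by (intro tri_run) simp_all
        qed
      qed
    qed
  qed (rule length_le)
  then show ?thesis
    by (rule tri_weaken) (auto simp: P_def)
qed

lemma tri_write_cover:
  assumes "arrs s 0 = cell" "regs s 2 = length vs" "output_of s = [1]"
  shows "tri write_cover s (L * 7 + 2)
    (\<lambda>s'. output_of s' = 1 # filter (\<lambda>v. pos v \<in> marked (arrs s 5)) vs)"
proof -
  define P where "P j t \<longleftrightarrow> arrs t 0 = cell \<and> regs t 2 = length vs \<and> regs t 8 = j \<and>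
    arrs t 5 = arrs s 5 \<and>
    output_of t = 1 # filter (\<lambda>v. pos v \<in> marked (arrs s 5)) (take j vs)" for j t
  have "tri write_cover s (L * (5 + 2) + 2) (P (length vs))"
    unfolding write_cover_def
  proof (rule tri_For)
    show "P 0 (s\<lparr>regs := (regs s)(8 := 0)\<rparr>)"
      using assms by (simp add: P_def output_of_def)
    show "regs t 8 = j \<and> regs t 2 = length vs" if "P j t" for j t
      using that by (simp add: P_def)
    fix j t assume j: "j < length vs" and P: "P j t"
    have "pos (vs ! j) \<in> marked (arrs s 5) \<longleftrightarrow> arrs s 5 (pos (vs ! j)) = 1"
      using literals_nth[OF j] by (simp add: marked_def)
    then show "tri (SetReg 12 (Get 0 (Plus (R 8) (N 1))) ;;
      If (Eq (Get 5 (plit (R 12))) (N 1))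
        (SetArr 1 (R 1) (R 12) ;; SetReg 1 (Plus (R 1) (N 1))) Skip) t 5
      (\<lambda>s'. P (Suc j) (s'\<lparr>regs := (regs s')(8 := Suc (regs s' 8))\<rparr>))"
      using P cell_vertex[OF j]
      by (intro tri_run) (simp_all add: P_def output_of_def take_Suc_conv_app_nth[OF j])
  qed (rule length_le)
  then show ?thesis
    by (rule tri_weaken) (simp_all add: P_def)
qed

lemma tri_answer:
  assumes "ready s"
  shows "tri answer s (test_time L + (L * 7 + 5)) (\<lambda>s'. output_of s' =
    (if consistent (set vs) (closure I (chosen s))
     then 1 # filter (\<lambda>v. pos v \<in> closure I (chosen s)) vs else [0]))"
proof -
  define X where "X = closure I (chosen s)"
  define c where "c \<longleftrightarrow> consistent (set vs) X"
  let ?Q = "\<lambda>s'. output_of s' = (if c then 1 # filter (\<lambda>v. pos v \<in> X) vs else [0])"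
  have "tri answer s (test_time L + (1 + ((1 + (L * 7 + 2)) + 1))) ?Q"
    unfolding answer_def
  proof (rule tri_Seq[OF tri_test[OF assms, folded X_def, folded c_def]])
    fix t assume t: "keeps s t \<and> marked (arrs t 5) = X \<and> regs t 11 = (if c then 0 else 1)"
    have "ready t" by (rule ready_keeps[OF assms conjunct1[OF t]])
    let ?t = "t\<lparr>regs := (regs t)(1 := 1)\<rparr>"
    show "tri (SetReg 1 (N 1) ;;
        If (Eq (R 11) (N 1)) (SetArr 1 (N 0) (N 0)) (SetArr 1 (N 0) (N 1) ;; write_cover))
      t (1 + ((1 + (L * 7 + 2)) + 1)) ?Q"
    proof (rule tri_Seq[where P = "\<lambda>s'. s' = ?t"])
      fix s' assume s': "s' = ?t"
      show "tri (If (Eq (R 11) (N 1)) (SetArr 1 (N 0) (N 0)) (SetArr 1 (N 0) (N 1) ;; write_cover))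
        s' ((1 + (L * 7 + 2)) + 1) ?Q"
        unfolding s'
      proof (rule tri_If)
        assume "bval (Eq (R 11) (N 1)) ?t"
        then have "\<not> c" using t by (cases c) simp_all
        then show "tri (SetArr 1 (N 0) (N 0)) ?t (1 + (L * 7 + 2)) ?Q"
          by (intro tri_run) (simp_all add: output_of_def)
      next
        assume "\<not> bval (Eq (R 11) (N 1)) ?t"
        then have c using t by (cases c) simp_all
        let ?u = "run (SetArr 1 (N 0) (N 1)) ?t"
        show "tri (SetArr 1 (N 0) (N 1) ;; write_cover) ?t (1 + (L * 7 + 2)) ?Q"
        proof (rule tri_Seq[where P = "\<lambda>s'. s' = ?u"])
          have "tri write_cover ?u (L * 7 + 2)
            (\<lambda>s'. output_of s' = 1 # filter (\<lambda>v. pos v \<in> marked (arrs ?u 5)) vs)"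
            using \<open>ready t\<close> by (intro tri_write_cover) (simp_all add: ready_def output_of_def)
          then show "tri write_cover s' (L * 7 + 2) ?Q" if "s' = ?u" for s'
            unfolding that using t \<open>c\<close> by simp
        qed (rule tri_run; simp)
      qed
    qed (rule tri_run; simp)
  qed
  then show ?thesis
    unfolding c_def X_def by (rule tri_weaken) simp_all
qed

end

section \<open>The whole program and its polynomial bound\<close>

definition total_time :: "'a::comm_semiring_1 \<Rightarrow> 'a" where
  "total_time l = 3 + ((l * 9 + 2) + (2 + ((l * (l * (l * 7 + 4) + 7) + 2) +
     ((l * (test_time l + 7) + 2) + (test_time l + (l * 7 + 5))))))"

lemma total_time_mono: "l \<le> l' \<Longrightarrow> total_time l \<le> total_time (l' :: nat)"
  unfolding total_time_def test_time_def imp_bound_def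
  by (intro add_mono mult_mono order_refl) simp_all

lemma poly_total_time: "poly (total_time p) x = total_time (poly p x)"
  for p :: "nat poly"
  by (simp add: total_time_def test_time_def imp_bound_def)

context encoded
begin

lemma tri_sparse_vc:
  "tri sparse_vc (init_state (encode vs es bs)) (total_time L) (\<lambda>s.
    if solvable then \<exists>hs. output_of s = 1 # hs \<and> solution (set vs) (set es) (set ` set bs) (set hs)
    else output_of s = [0])"
  unfolding sparse_vc_def total_time_def
proof (rule tri_Seq)
  let ?P = "\<lambda>s. reading s \<and> regs s 3 = length es \<and> regs s 5 = length vs + 2 \<and> regs s 6 = 0"
  have "arrs (init_state (encode vs es bs)) 0 = cell"
    by (auto simp: init_state_def cell_def)
  then show "tri (SetReg 2 (Get 0 (N 0)) ;; SetReg 3 (Get 0 (Plus (R 2) (N 1))) ;;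
      SetReg 5 (Plus (R 2) (N 2))) (init_state (encode vs es bs)) 3 ?P"
    by (intro tri_run)
      (simp_all add: reading_def cell_num_vertices cell_num_edges, simp_all add: init_state_def)
  fix s1 assume "?P s1"
  show "tri (read_edges ;; (SetReg 4 (Get 0 (R 5)) ;; SetReg 5 (Plus (R 5) (N 1))) ;;
      read_sets ;; decide_all ;; answer) s1
    ((L * 9 + 2) + (2 + ((L * (L * (L * 7 + 4) + 7) + 2) +
     ((L * (test_time L + 7) + 2) + (test_time L + (L * 7 + 5)))))) (\<lambda>s.
    if solvable then \<exists>hs. output_of s = 1 # hs \<and> solution (set vs) (set es) (set ` set bs) (set hs)
    else output_of s = [0])"
  proof (rule tri_Seq[OF tri_read_edges])
    fix s2 assume s2: "reading s2 \<and> regs s2 5 = length vs + 2 + 2 * length es \<and>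
      regs s2 6 \<le> 2 * length es \<and> imps_of s2 = all_imps (set es) {}"
    let ?P = "\<lambda>s. reading s \<and> regs s 4 = length bs \<and> regs s 5 = offset 0 \<and> regs s 6 \<le> 2 * L \<and>
      imps_of s = all_imps (set es) {}"
    show "tri ((SetReg 4 (Get 0 (R 5)) ;; SetReg 5 (Plus (R 5) (N 1))) ;;
        read_sets ;; decide_all ;; answer) s2
      (2 + ((L * (L * (L * 7 + 4) + 7) + 2) +
       ((L * (test_time L + 7) + 2) + (test_time L + (L * 7 + 5))))) (\<lambda>s.
      if solvable then \<exists>hs. output_of s = 1 # hs \<and> solution (set vs) (set es) (set ` set bs) (set hs)
      else output_of s = [0])"
    proof (rule tri_Seq[where P = ?P])
      show "tri (SetReg 4 (Get 0 (R 5)) ;; SetReg 5 (Plus (R 5) (N 1))) s2 2 ?P"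
        using s2 cell_num_sets length_le(2)
        by (intro tri_run) (auto simp: reading_def offset_0)
      fix s3 assume "?P s3"
      then show "tri (read_sets ;; decide_all ;; answer) s3
        ((L * (L * (L * 7 + 4) + 7) + 2) +
         ((L * (test_time L + 7) + 2) + (test_time L + (L * 7 + 5)))) (\<lambda>s.
        if solvable then \<exists>hs. output_of s = 1 # hs \<and> solution (set vs) (set es) (set ` set bs) (set hs)
        else output_of s = [0])"
      proof (elim conjE, intro tri_Seq[OF tri_read_sets])
        fix s4 assume "reading s4 \<and> regs s4 6 \<le> K \<and> imps_of s4 = I"
        then have "ready s4" "chosen s4 = {}"
          by (auto simp: reading_def ready_def marked_def)
        then show "tri (decide_all ;; answer) s4
          ((L * (test_time L + 7) + 2) + (test_time L + (L * 7 + 5))) (\<lambda>s.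
          if solvable then \<exists>hs. output_of s = 1 # hs \<and> solution (set vs) (set es) (set ` set bs) (set hs)
          else output_of s = [0])"
        proof (intro tri_Seq[OF tri_decide_all])
          fix s5 assume s5: "ready s5 \<and> (\<forall>v\<in>set vs. pos v \<in> chosen s5 \<or> neg v \<in> chosen s5) \<and>
            (solvable \<longrightarrow> consistent (set vs) (closure I (chosen s5)))"
          have cons: "solution (set vs) (set es) (set ` set bs) {v \<in> set vs. pos v \<in> closure I (chosen s5)}"
            if "consistent (set vs) (closure I (chosen s5))"
            using s5 that by (intro solution_of_total) auto
          show "tri answer s5 (test_time L + (L * 7 + 5)) (\<lambda>s.
            if solvable then \<exists>hs. output_of s = 1 # hs \<and> solution (set vs) (set es) (set ` set bs) (set hs)
            else output_of s = [0])"
            by (rule tri_weaken[OF tri_answer[OF conjunct1[OF s5]]]) (use s5 cons in auto)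
        qed
      qed auto
    qed
  qed (use \<open>?P s1\<close> in auto)
qed

end

text \<open>At most one common element means that any two coincide, which turns sparseness into
  binary clauses. The listed sets are finite, so \<open>card\<close> does not degenerate to
  \<open>0\<close>.\<close>

lemma solution_iff:
  "solution (set vs) (set es) (set ` set bs) H \<longleftrightarrow>
    vertex_cover (set vs) ((\<lambda>(u, v). {u, v}) ` set es) H \<and> (\<forall>B\<in>set ` set bs. card (H \<inter> B) \<le> 1)"
proof -
  have "card (H \<inter> set b) \<le> 1 \<longleftrightarrow> (\<forall>u\<in>set b. \<forall>v\<in>set b. u \<in> H \<longrightarrow> v \<in> H \<longrightarrow> u = v)" for b
    using card_le_Suc0_iff_eq[of "H \<inter> set b"] by auto
  moreover have "H \<inter> (case e of (u, v) \<Rightarrow> {u, v}) \<noteq> {} \<longleftrightarrow> (case e of (u, v) \<Rightarrow> u \<in> H \<or> v \<in> H)" for e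
    by (cases e) auto
  ultimately show ?thesis
    unfolding solution_def vertex_cover_def by simp
qed

theorem theorem2:
  shows "\<exists>(c :: com) (p :: nat poly). \<forall>V E \<B> x.
    simple_graph V E \<longrightarrow> \<B> \<subseteq> Pow V \<longrightarrow> encodes_instance x V E \<B> \<longrightarrow>
    (\<exists>t s. exec c (init_state x) t s \<and> t \<le> poly p (input_size x) \<and>
      (if \<exists>H. vertex_cover V E H \<and> (\<forall>B\<in>\<B>. card (H \<inter> B) \<le> 1)
       then \<exists>hs. output_of s = 1 # hs \<and>
              vertex_cover V E (set hs) \<and> (\<forall>B\<in>\<B>. card (set hs \<inter> B) \<le> 1)
       else output_of s = [0]))"
proof -
  define w where "w = cweight sparse_vc"
  define T where "T = total_time [:0, 1 :: nat:]"
  \<comment> \<open>Numbers start with at most \<open>m\<close> bits and gain at most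
    \<open>w\<close> per step, so each of the at most \<open>total_time m\<close> steps costs at
    most \<open>stepcost w (m + total_time m * w)\<close>.\<close>
  define p where "p = T * ([:w:] * ([:0, 1:] + T * [:w:] + [:w:] + 1) + 1)"
  have p: "poly p m = total_time m * stepcost w (m + total_time m * w)" for m
    by (simp add: p_def T_def poly_total_time stepcost_def mult.commute)
  have "\<exists>t s. exec sparse_vc (init_state x) t s \<and> t \<le> poly p (input_size x) \<and>
      (if \<exists>H. vertex_cover V E H \<and> (\<forall>B\<in>\<B>. card (H \<inter> B) \<le> 1)
       then \<exists>hs. output_of s = 1 # hs \<and>
              vertex_cover V E (set hs) \<and> (\<forall>B\<in>\<B>. card (set hs \<inter> B) \<le> 1)
       else output_of s = [0])"
    if "simple_graph V E" "\<B> \<subseteq> Pow V" "encodes_instance x V E \<B>" for V E \<B> x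
  proof -
    obtain vs es bs where x: "x = encode vs es bs" and V: "V = set vs"
      and E: "E = (\<lambda>(u, v). {u, v}) ` set es" and B: "\<B> = set ` set bs"
      using \<open>encodes_instance x V E \<B>\<close> unfolding encodes_instance_def by blast
    interpret encoded vs es bs
    proof
      show "set es \<subseteq> set vs \<times> set vs"
        using \<open>simple_graph V E\<close> unfolding simple_graph_def V E by fastforce
      show "set b \<subseteq> set vs" if "b \<in> set bs" for b
        using \<open>\<B> \<subseteq> Pow V\<close> that unfolding V B by blast
    qed
    obtain n s where s: "steps sparse_vc (init_state x) n s" "n \<le> total_time (length x)"
      "if solvable then \<exists>hs. output_of s = 1 # hs \<and> solution (set vs) (set es) (set ` set bs) (set hs)
       else output_of s = [0]"
      using tri_sparse_vc unfolding tri_def x by blast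
    let ?m = "input_size x"
    obtain t where t: "exec sparse_vc (init_state x) t s" "t \<le> n * stepcost w (?m + n * w)"
      using steps_exec[OF s(1) _ fits_init_state] w_def by blast
    have "n \<le> total_time ?m"
      using s(2) total_time_mono[OF length_le_input_size] by (rule le_trans)
    then have "n * stepcost w (?m + n * w) \<le> poly p ?m"
      unfolding p by (intro mult_mono stepcost_mono add_mono) simp_all
    with t(2) have "t \<le> poly p ?m" by (rule le_trans)
    with t(1) s(3) show ?thesis
      unfolding solution_iff V E B by blast
  qed
  then show ?thesis by blast
qed

end
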